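(* Let $n\in\mathbb{N}$, let $t_f\in(0,\infty]$, let $\mathcal{I}=[0,t_f)$, and let \[ \Phi:\mathcal{I}\to\mathrm{CPTP}(n),\qquad t\mapsto \Phi_t, \] be a dynamical curve which is analytic in $t$. Then there exist a finite-dimensional Hilbert space $E$ with $\dim E\leq n^2$, a unit vector $\omega\in E$, and a family of unitary operators \[ U_t:\mathbb{C}^n\otimes E\to\mathbb{C}^n\otimes E,\qquad t\in\mathcal{I}, \] such that \[ \Phi_t(\rho)=\mathrm{Tr}_E\left(U_t(\rho\otimes|\omega\rangle\langle\omega|)U_t^\dagger\right) \] for all $\rho\in\mathcal{B}(\mathbb{C}^n)$, and such that the map $t\mapsto U_t$ is analytic on $(0,t_f)$. In particular, every quantum dynamical semigroup $(\Phi_t)_{t\geq 0}$ on $\mathbb{C}^n$ admits such a dilation, with $t\mapsto U_t$ analytic for $t>0$.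
   Context: $\mathcal{B}(\mathbb{C}^n)$ denotes the space of linear operators on $\mathbb{C}^n$. $\mathrm{CPTP}(n)$ denotes the set of all completely positive, trace-preserving linear maps $\mathcal{B}(\mathbb{C}^n)\to\mathcal{B}(\mathbb{C}^n)$ (quantum channels). A dynamical curve on an interval $\mathcal{I}\subseteq\mathbb{R}$ is any map $\mathcal{I}\to\mathrm{CPTP}(n)$, $t\mapsto\Phi_t$. Regularity (continuity, analyticity) of operator- or map-valued functions of $t$ is understood entrywise with respect to any fixed basis (equivalently in any norm, since all spaces are finite-dimensional); analyticity means real-analyticity in $t$ on the given interval. $\mathrm{Tr}_E$ denotes the partial trace over $E$, and $U_t^\dagger$ the adjoint of $U_t$. A quantum dynamical semigroup is a dynamical curve $(\Phi_t)_{t\geq 0}$ with $\Phi_0=\mathrm{id}$, $\Phi_{t+s}=\Phi_t\circ\Phi_s$ for all $s,t\geq 0$, and $t\mapsto\Phi_t$ continuous. *)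

theory Defs
  imports "HOL-Analysis.Analysis" "Jordan_Normal_Form.Matrix"
begin

definition real_analytic_on :: "real set \<Rightarrow> (real \<Rightarrow> complex) \<Rightarrow> bool" where
  "real_analytic_on S f \<longleftrightarrow>
     (\<forall>x\<in>S. \<exists>r>0. \<exists>c :: nat \<Rightarrow> complex.
        \<forall>y\<in>S. \<bar>y - x\<bar> < r \<longrightarrow> (\<lambda>k. c k * complex_of_real (y - x) ^ k) sums f y)"

definition mat_analytic_on :: "nat \<Rightarrow> nat \<Rightarrow> real set \<Rightarrow> (real \<Rightarrow> complex mat) \<Rightarrow> bool" where
  "mat_analytic_on p q S M \<longleftrightarrow> (\<forall>i<p. \<forall>j<q. real_analytic_on S (\<lambda>t. M t $$ (i, j)))"

definition mat_unit :: "nat \<Rightarrow> nat \<Rightarrow> nat \<Rightarrow> complex mat" where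
  "mat_unit n k l = mat n n (\<lambda>(i, j). if i = k \<and> j = l then 1 else 0)"

text \<open>A map on B(C^n) is analytic (resp. continuous) iff all entries of its matrix w.r.t. the
  basis of matrix units are, i.e. iff each entry of each Phi_t(E_kl) is.\<close>
definition map_analytic_on :: "nat \<Rightarrow> real set \<Rightarrow> (real \<Rightarrow> complex mat \<Rightarrow> complex mat) \<Rightarrow> bool" where
  "map_analytic_on n S \<Phi> \<longleftrightarrow> (\<forall>k<n. \<forall>l<n. mat_analytic_on n n S (\<lambda>t. \<Phi> t (mat_unit n k l)))"

definition map_continuous_on :: "nat \<Rightarrow> real set \<Rightarrow> (real \<Rightarrow> complex mat \<Rightarrow> complex mat) \<Rightarrow> bool" where
  "map_continuous_on n S \<Phi> \<longleftrightarrow>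
     (\<forall>k<n. \<forall>l<n. \<forall>i<n. \<forall>j<n. continuous_on S (\<lambda>t. \<Phi> t (mat_unit n k l) $$ (i, j)))"

definition mtrace :: "complex mat \<Rightarrow> complex" where
  "mtrace A = (\<Sum>i<dim_row A. A $$ (i, i))"

definition dagger :: "complex mat \<Rightarrow> complex mat" where
  "dagger A = mat (dim_col A) (dim_row A) (\<lambda>(i, j). cnj (A $$ (j, i)))"

definition psd :: "nat \<Rightarrow> complex mat \<Rightarrow> bool" where
  "psd d A \<longleftrightarrow> A \<in> carrier_mat d d \<and>
     (\<forall>v \<in> carrier_vec d.
        let q = (\<Sum>i<d. \<Sum>j<d. cnj (v $ i) * A $$ (i, j) * v $ j) in Im q = 0 \<and> Re q \<ge> 0)"

text \<open>Kronecker (tensor) product; index (i,a) of C^p (x) C^q corresponds to i*q + a.\<close>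
definition kron :: "complex mat \<Rightarrow> complex mat \<Rightarrow> complex mat" where
  "kron A B = mat (dim_row A * dim_row B) (dim_col A * dim_col B)
     (\<lambda>(i, j). A $$ (i div dim_row B, j div dim_col B) * B $$ (i mod dim_row B, j mod dim_col B))"

text \<open>id_k (x) Phi acting on B(C^k (x) C^n), computed blockwise.\<close>
definition ampliation :: "nat \<Rightarrow> nat \<Rightarrow> (complex mat \<Rightarrow> complex mat) \<Rightarrow> complex mat \<Rightarrow> complex mat" where
  "ampliation k n \<Phi> X = mat (k * n) (k * n)
     (\<lambda>(p, q). \<Phi> (mat n n (\<lambda>(a, b). X $$ ((p div n) * n + a, (q div n) * n + b))) $$ (p mod n, q mod n))"

definition CPTP :: "nat \<Rightarrow> (complex mat \<Rightarrow> complex mat) \<Rightarrow> bool" where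
  "CPTP n \<Phi> \<longleftrightarrow>
     (\<forall>A \<in> carrier_mat n n. \<Phi> A \<in> carrier_mat n n) \<and>
     (\<forall>A \<in> carrier_mat n n. \<forall>B \<in> carrier_mat n n. \<forall>c :: complex.
        \<Phi> (c \<cdot>\<^sub>m A + B) = c \<cdot>\<^sub>m \<Phi> A + \<Phi> B) \<and>
     (\<forall>A \<in> carrier_mat n n. mtrace (\<Phi> A) = mtrace A) \<and>
     (\<forall>k. \<forall>X. psd (k * n) X \<longrightarrow> psd (k * n) (ampliation k n \<Phi> X))"

definition ptrace_E :: "nat \<Rightarrow> nat \<Rightarrow> complex mat \<Rightarrow> complex mat" where
  "ptrace_E n m X = mat n n (\<lambda>(i, j). \<Sum>a<m. X $$ (i * m + a, j * m + a))"

definition unitary_mat :: "nat \<Rightarrow> complex mat \<Rightarrow> bool" where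
  "unitary_mat d U \<longleftrightarrow> U \<in> carrier_mat d d \<and> dagger U * U = 1\<^sub>m d \<and> U * dagger U = 1\<^sub>m d"

definition ketbra :: "complex vec \<Rightarrow> complex mat" where
  "ketbra w = mat (dim_vec w) (dim_vec w) (\<lambda>(i, j). w $ i * cnj (w $ j))"

definition unit_vector :: "nat \<Rightarrow> complex vec \<Rightarrow> bool" where
  "unit_vector m w \<longleftrightarrow> w \<in> carrier_vec m \<and> (\<Sum>i<m. (cmod (w $ i))\<^sup>2) = 1"

definition analytic_unitary_dilation ::
  "nat \<Rightarrow> (real \<Rightarrow> complex mat \<Rightarrow> complex mat) \<Rightarrow> real set \<Rightarrow> real set \<Rightarrow> bool" where
  "analytic_unitary_dilation n \<Phi> I J \<longleftrightarrow>
     (\<exists>m :: nat. \<exists>\<omega> :: complex vec. \<exists>U :: real \<Rightarrow> complex mat.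
        m \<le> n\<^sup>2 \<and> unit_vector m \<omega> \<and>
        (\<forall>t\<in>I. unitary_mat (n * m) (U t)) \<and>
        (\<forall>t\<in>I. \<forall>\<rho> \<in> carrier_mat n n.
            \<Phi> t \<rho> = ptrace_E n m (U t * kron \<rho> (ketbra \<omega>) * dagger (U t))) \<and>
        mat_analytic_on (n * m) (n * m) J U)"

definition quantum_dynamical_semigroup :: "nat \<Rightarrow> (real \<Rightarrow> complex mat \<Rightarrow> complex mat) \<Rightarrow> bool" where
  "quantum_dynamical_semigroup n \<Phi> \<longleftrightarrow>
     (\<forall>t\<ge>0. CPTP n (\<Phi> t)) \<and>
     (\<forall>\<rho> \<in> carrier_mat n n. \<Phi> 0 \<rho> = \<rho>) \<and>
     (\<forall>s\<ge>0. \<forall>t\<ge>0. \<forall>\<rho> \<in> carrier_mat n n. \<Phi> (t + s) \<rho> = \<Phi> t (\<Phi> s \<rho>)) \<and>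
     map_continuous_on n {0..} \<Phi>"

end

theory Submission
  imports Defs "HOL-Complex_Analysis.Complex_Analysis" "Jordan_Normal_Form.Determinant"
begin

text \<open>The Choi matrix of \<open>\<Phi> t\<close> is a positive semidefinite matrix that is analytic in \<open>t\<close>. On an open
  interval, a nonnegative analytic function has an analytic square root (signs are chosen so as to
  flip at the zeros of odd half-order), and an analytic function divides another one as soon as it
  locally dominates it. Hence Cholesky's algorithm runs over the ring of analytic functions: a pivot
  that does not vanish identically has a square root which, by the Cauchy-Schwarz inequality for
  positive semidefinite matrices, divides its column, and the Schur complement stays positive
  semidefinite by continuity. The columns of the Cholesky factor are analytic Kraus operators, i.e.
  an analytic isometry, and the same two facts complete its columns one by one to an analytic unitary. At
  \<open>t = 0\<close>, where no regularity is required, any dilation of the single channel \<open>\<Phi> 0\<close> will do, for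
  instance the one obtained from the constant curve. A continuous semigroup is analytic since it
  solves a linear ODE with constant coefficients.\<close>

section \<open>Real-analytic germs\<close>

text \<open>The endpoint 0 is a genuine obstacle: at \<open>t = 0\<close> the Choi matrix may grow
  linearly in a direction in which it vanishes, as for dephasing, and a simple zero has no analytic
  square root. At interior points positivity on both sides forces zeros of even order. These zeros
  may still accumulate at an end of the interval, so signs and quotients have to be made global
  without a finite list of zeros. Cholesky's algorithm is chosen because it reduces the matrix
  problem to scalar functions: no eigenvalues have to be followed, and rank drops at isolated points
  are harmless. The bound \<open>n\<^sup>2\<close> is the size of the Choi matrix; the factor has
  that many columns, some possibly zero, and the dimension is not reduced to the rank. Germs are
  encoded by holomorphic extensions, so arithmetic, orders of zeros and branches of the root come
  from complex analysis, while the functions themselves live on the reals and may be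
  conjugated.\<close>

definition real_analytic_at :: "(real \<Rightarrow> complex) \<Rightarrow> real \<Rightarrow> bool" where
  "real_analytic_at f x \<longleftrightarrow>
     (\<exists>F. F analytic_on {complex_of_real x} \<and> (\<forall>\<^sub>F t in nhds x. f t = F (complex_of_real t)))"

lemma real_analytic_atI:
  assumes "F analytic_on {complex_of_real x}" "\<forall>\<^sub>F t in nhds x. f t = F (complex_of_real t)"
  shows "real_analytic_at f x"
  using assms unfolding real_analytic_at_def by blast

lemma real_analytic_at_cong:
  assumes "\<forall>\<^sub>F t in nhds x. f t = g t"
  shows "real_analytic_at f x \<longleftrightarrow> real_analytic_at g x"
proof -
  have "real_analytic_at g x" if "real_analytic_at f x" "\<forall>\<^sub>F t in nhds x. f t = g t" for f g
  proof -
    from that(1) obtain F where F: "F analytic_on {complex_of_real x}"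
        "\<forall>\<^sub>F t in nhds x. f t = F (complex_of_real t)"
      unfolding real_analytic_at_def by blast
    from F(2) that(2) have "\<forall>\<^sub>F t in nhds x. g t = F (complex_of_real t)"
      by eventually_elim simp
    with F(1) show ?thesis by (rule real_analytic_atI)
  qed
  from this[of f g] this[of g f] assms show ?thesis by (auto simp: eq_commute)
qed

lemma real_analytic_at_transfer:
  assumes "real_analytic_at g x" "\<forall>\<^sub>F t in nhds x. f t = g t"
  shows "real_analytic_at f x"
  using real_analytic_at_cong[OF assms(2)] assms(1) by simp

lemma real_analytic_at_const [simp]: "real_analytic_at (\<lambda>_. c) x"
  by (rule real_analytic_atI[of "\<lambda>_. c"]) auto

lemma real_analytic_at_of_real [simp]: "real_analytic_at complex_of_real x"
  by (rule real_analytic_atI[of "\<lambda>z. z"]) auto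

lemma real_analytic_at_add:
  assumes "real_analytic_at f x" "real_analytic_at g x"
  shows "real_analytic_at (\<lambda>t. f t + g t) x"
proof -
  from assms obtain F G where F: "F analytic_on {complex_of_real x}" "G analytic_on {complex_of_real x}"
        "\<forall>\<^sub>F t in nhds x. f t = F (complex_of_real t)" "\<forall>\<^sub>F t in nhds x. g t = G (complex_of_real t)"
      unfolding real_analytic_at_def by blast
  from F(3,4) have "\<forall>\<^sub>F t in nhds x. f t + g t = F (complex_of_real t) + G (complex_of_real t)"
    by eventually_elim simp
  with F(1,2) show ?thesis
    by (intro real_analytic_atI[of "\<lambda>z. F z + G z"] analytic_on_add) auto
qed

lemma real_analytic_at_mult:
  assumes "real_analytic_at f x" "real_analytic_at g x"
  shows "real_analytic_at (\<lambda>t. f t * g t) x"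
proof -
  from assms obtain F G where F: "F analytic_on {complex_of_real x}" "G analytic_on {complex_of_real x}"
        "\<forall>\<^sub>F t in nhds x. f t = F (complex_of_real t)" "\<forall>\<^sub>F t in nhds x. g t = G (complex_of_real t)"
      unfolding real_analytic_at_def by blast
  from F(3,4) have "\<forall>\<^sub>F t in nhds x. f t * g t = F (complex_of_real t) * G (complex_of_real t)"
    by eventually_elim simp
  with F(1,2) show ?thesis
    by (intro real_analytic_atI[of "\<lambda>z. F z * G z"] analytic_on_mult) auto
qed

lemma real_analytic_at_uminus:
  assumes "real_analytic_at f x"
  shows "real_analytic_at (\<lambda>t. - f t) x"
  using real_analytic_at_mult[of "\<lambda>_. -1" x f] assms by simp

lemma real_analytic_at_diff:
  assumes "real_analytic_at f x" "real_analytic_at g x"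
  shows "real_analytic_at (\<lambda>t. f t - g t) x"
  using real_analytic_at_add[of f x "\<lambda>t. - g t"] real_analytic_at_uminus[of g x] assms by simp

lemma real_analytic_at_power:
  assumes "real_analytic_at f x"
  shows "real_analytic_at (\<lambda>t. f t ^ k) x"
proof (induction k)
  case (Suc k)
  show ?case using real_analytic_at_mult[OF assms Suc] by simp
qed simp

lemma real_analytic_at_sum:
  assumes "\<And>i. i \<in> I \<Longrightarrow> real_analytic_at (f i) x"
  shows "real_analytic_at (\<lambda>t. \<Sum>i\<in>I. f i t) x"
  using assms
proof (induction I rule: infinite_finite_induct)
  case (insert i I)
  have "real_analytic_at (\<lambda>t. f i t + (\<Sum>i\<in>I. f i t)) x"
    by (rule real_analytic_at_add) (simp_all add: insert)
  thus ?case using insert.hyps by simp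
qed simp_all

text \<open>Conjugation is not holomorphic, but the reflected function
  \<open>cnj (F (cnj z))\<close> is, and on the real axis it agrees with \<open>cnj (f t)\<close>.
  Hence inner products of analytic vectors are analytic.\<close>

lemma real_analytic_at_cnj:
  assumes "real_analytic_at f x"
  shows "real_analytic_at (\<lambda>t. cnj (f t)) x"
proof -
  from assms obtain F where F: "F analytic_on {complex_of_real x}"
      "\<forall>\<^sub>F t in nhds x. f t = F (complex_of_real t)"
    unfolding real_analytic_at_def by blast
  from F(1) obtain e where e: "e > 0" "F holomorphic_on ball (complex_of_real x) e"
    by (auto simp: analytic_on_def)
  have "cnj ` ball (complex_of_real x) e \<subseteq> ball (complex_of_real x) e"
  proof (safe)
    fix z assume "z \<in> ball (complex_of_real x) e"
    thus "cnj z \<in> ball (complex_of_real x) e"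
      using complex_mod_cnj[of "complex_of_real x - z"] by (simp add: dist_norm)
  qed
  hence "cnj \<circ> F \<circ> cnj holomorphic_on ball (complex_of_real x) e"
    by (intro holomorphic_on_compose_cnj_cnj holomorphic_on_subset[OF e(2)]) auto
  with e have "cnj \<circ> F \<circ> cnj analytic_on {complex_of_real x}"
    by (auto simp: analytic_on_def)
  moreover have "\<forall>\<^sub>F t in nhds x. cnj (f t) = (cnj \<circ> F \<circ> cnj) (complex_of_real t)"
    using F(2) by eventually_elim simp
  ultimately show ?thesis by (rule real_analytic_atI)
qed

lemma filterlim_of_real_nhds:
  "filterlim complex_of_real (nhds (complex_of_real x)) (nhds x)"
proof -
  have "isCont complex_of_real x" by (rule continuous_of_real[OF continuous_ident])
  thus ?thesis by (simp only: isCont_def tendsto_at_iff_tendsto_nhds)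
qed

lemma real_analytic_at_imp_isCont:
  assumes "real_analytic_at f x"
  shows "isCont f x"
proof -
  from assms obtain F where F: "F analytic_on {complex_of_real x}"
      "\<forall>\<^sub>F t in nhds x. f t = F (complex_of_real t)"
    unfolding real_analytic_at_def by blast
  have "isCont F (complex_of_real x)"
    using F(1) by (simp add: analytic_at_imp_isCont)
  hence "isCont (\<lambda>t. F (complex_of_real t)) x"
    by (rule isCont_o2[rotated]) simp
  thus ?thesis using isCont_cong[OF F(2)] by simp
qed

lemma eventually_real_analytic_at:
  assumes "real_analytic_at f x"
  shows "\<forall>\<^sub>F t in nhds x. real_analytic_at f t"
proof -
  from assms obtain F where F: "F analytic_on {complex_of_real x}"
      "\<forall>\<^sub>F t in nhds x. f t = F (complex_of_real t)"
    unfolding real_analytic_at_def by blast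
  from F(1) obtain e where e: "e > 0" "F holomorphic_on ball (complex_of_real x) e"
    by (auto simp: analytic_on_def)
  have an: "F analytic_on ball (complex_of_real x) e"
    using e by (simp add: analytic_on_open)
  have "\<forall>\<^sub>F z in nhds (complex_of_real x). z \<in> ball (complex_of_real x) e"
    using e by (intro eventually_nhds_in_open) auto
  hence "\<forall>\<^sub>F t in nhds x. complex_of_real t \<in> ball (complex_of_real x) e"
    using filterlim_of_real_nhds[of x] unfolding filterlim_iff by blast
  moreover have "\<forall>\<^sub>F s in nhds x. \<forall>\<^sub>F t in nhds s. f t = F (complex_of_real t)"
    using F(2) by (simp add: eventually_eventually)
  ultimately show ?thesis
  proof eventually_elim
    case (elim t)
    thus ?case using an by (intro real_analytic_atI[of F]) (auto intro: analytic_on_subset)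
  qed
qed

lemma real_analytic_at_divide:
  assumes "real_analytic_at f x" "real_analytic_at g x" "g x \<noteq> 0"
  shows "real_analytic_at (\<lambda>t. f t / g t) x"
proof -
  from assms obtain F G where F: "F analytic_on {complex_of_real x}" "G analytic_on {complex_of_real x}"
        "\<forall>\<^sub>F t in nhds x. f t = F (complex_of_real t)" "\<forall>\<^sub>F t in nhds x. g t = G (complex_of_real t)"
      unfolding real_analytic_at_def by blast
  have "G (complex_of_real x) \<noteq> 0"
    using eventually_nhds_x_imp_x[OF F(4)] assms(3) by simp
  moreover from F(3,4) have "\<forall>\<^sub>F t in nhds x. f t / g t = F (complex_of_real t) / G (complex_of_real t)"
    by eventually_elim simp
  ultimately show ?thesis using F(1,2)
    by (intro real_analytic_atI[of "\<lambda>z. F z / G z"] analytic_on_divide) auto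
qed

lemma real_analytic_at_csqrt:
  assumes "real_analytic_at f x" "f x \<notin> \<real>\<^sub>\<le>\<^sub>0"
  shows "real_analytic_at (\<lambda>t. csqrt (f t)) x"
proof -
  from assms(1) obtain F where F: "F analytic_on {complex_of_real x}"
      "\<forall>\<^sub>F t in nhds x. f t = F (complex_of_real t)"
    unfolding real_analytic_at_def by blast
  have "F (complex_of_real x) \<notin> \<real>\<^sub>\<le>\<^sub>0"
    using eventually_nhds_x_imp_x[OF F(2)] assms(2) by simp
  hence "(\<lambda>z. csqrt (F z)) analytic_on {complex_of_real x}"
    using analytic_on_compose_gen[OF F(1), of csqrt "- \<real>\<^sub>\<le>\<^sub>0"]
    by (auto simp: o_def analytic_on_open closed_nonpos_Reals_complex open_Compl holomorphic_on_csqrt)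
  moreover have "\<forall>\<^sub>F t in nhds x. csqrt (f t) = csqrt (F (complex_of_real t))"
    using F(2) by eventually_elim simp
  ultimately show ?thesis by (rule real_analytic_atI)
qed

text \<open>The series represents \<open>f\<close> only within \<open>S\<close>, so at an end of an
  interval it is silent about one side. An open set around \<open>x\<close> gives a full real
  neighbourhood, and convergence at the single real point \<open>x + d\<close> already gives a
  complex disc.\<close>

lemma real_analytic_on_imp_at:
  assumes f: "real_analytic_on S f" and T: "open T" "T \<subseteq> S" "x \<in> T"
  shows "real_analytic_at f x"
proof -
  from f T obtain r c where r: "r > 0"
    and c: "\<And>y. y \<in> S \<Longrightarrow> \<bar>y - x\<bar> < r \<Longrightarrow> (\<lambda>k. c k * complex_of_real (y - x) ^ k) sums f y"
    unfolding real_analytic_on_def by blast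
  from T obtain e where e: "e > 0" "ball x e \<subseteq> T" by (auto simp: open_contains_ball)
  define d where "d = min r e / 2"
  have d: "d > 0" "d < r" "d < e" using r e by (auto simp: d_def)
  have "x + d \<in> S" using e T d by (auto simp: subset_iff dist_real_def)
  hence "summable (\<lambda>k. c k * complex_of_real d ^ k)"
    using c[of "x + d"] d by (auto simp: sums_iff)
  hence rad: "conv_radius c \<ge> d"
    using conv_radius_geI[of c "complex_of_real d"] d by simp
  define F where "F = (\<lambda>z. \<Sum>k. c k * (z - complex_of_real x) ^ k)"
  have "F holomorphic_on ball (complex_of_real x) d"
  proof (rule power_series_holomorphic)
    fix w assume w: "w \<in> ball (complex_of_real x) d"
    hence "ereal (norm (w - complex_of_real x)) < conv_radius c"
      using rad by (metis dist_commute dist_norm ereal_less_eq(3) less_ereal.simps(1) less_le_trans mem_ball)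
    hence "summable (\<lambda>k. c k * (w - complex_of_real x) ^ k)"
      by (intro summable_in_conv_radius)
    thus "(\<lambda>k. c k * (w - complex_of_real x) ^ k) sums F w"
      by (simp add: F_def summable_sums)
  qed
  hence "F analytic_on {complex_of_real x}" using d by (auto simp: analytic_on_def)
  moreover have "\<forall>\<^sub>F t in nhds x. t \<in> ball x d"
    using d by (intro eventually_nhds_in_open) auto
  hence "\<forall>\<^sub>F t in nhds x. f t = F (complex_of_real t)"
  proof eventually_elim
    case (elim t)
    hence "t \<in> S" "\<bar>t - x\<bar> < r" using e T d by (auto simp: subset_iff dist_real_def)
    from c[OF this] show ?case by (simp add: F_def sums_iff)
  qed
  ultimately show ?thesis by (rule real_analytic_atI)
qed

lemma real_analytic_onI:
  assumes "\<And>x. x \<in> S \<Longrightarrow> real_analytic_at f x"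
  shows "real_analytic_on S f"
  unfolding real_analytic_on_def
proof
  fix x assume "x \<in> S"
  from assms[OF this] obtain F where F: "F analytic_on {complex_of_real x}"
      "\<forall>\<^sub>F t in nhds x. f t = F (complex_of_real t)"
    unfolding real_analytic_at_def by blast
  from F(1) obtain e where e: "e > 0" "F holomorphic_on ball (complex_of_real x) e"
    by (auto simp: analytic_on_def)
  from F(2) obtain d where d: "d > 0" "\<And>t. dist t x < d \<Longrightarrow> f t = F (complex_of_real t)"
    by (auto simp: eventually_nhds_metric)
  let ?c = "\<lambda>k. (deriv ^^ k) F (complex_of_real x) / fact k"
  have "(\<lambda>k. ?c k * complex_of_real (y - x) ^ k) sums f y" if "\<bar>y - x\<bar> < min d e" for y
  proof -
    have "dist (complex_of_real x) (complex_of_real y) < e"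
      using that by (simp add: dist_real_def abs_minus_commute)
    hence "(\<lambda>k. ?c k * (complex_of_real y - complex_of_real x) ^ k) sums F (complex_of_real y)"
      using holomorphic_power_series[OF e(2), of "complex_of_real y"] by simp
    thus ?thesis using d(2)[of y] that by (simp add: dist_real_def)
  qed
  thus "\<exists>r>0. \<exists>c. \<forall>y\<in>S. \<bar>y - x\<bar> < r \<longrightarrow> (\<lambda>k. c k * complex_of_real (y - x) ^ k) sums f y"
    using d(1) e(1) by (intro exI[of _ "min d e"] conjI exI[of _ ?c]) auto
qed

section \<open>Zeros, division and square roots on an interval\<close>

text \<open>The order of vanishing \<open>k\<close> and the unit \<open>g\<close> make analytic
  germs a discrete valuation ring; divisibility and the existence of square roots become statements
  about \<open>k\<close>.\<close>

lemma real_analytic_at_zero_or_factor: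
  assumes "real_analytic_at f x"
  shows "(\<forall>\<^sub>F t in nhds x. f t = 0) \<or>
    (\<exists>k g. real_analytic_at g x \<and> g x \<noteq> 0 \<and> (\<forall>\<^sub>F t in nhds x. f t = complex_of_real (t - x) ^ k * g t))"
proof -
  from assms obtain F where F: "F analytic_on {complex_of_real x}"
      "\<forall>\<^sub>F t in nhds x. f t = F (complex_of_real t)"
    unfolding real_analytic_at_def by blast
  from F(1) obtain e where e: "e > 0" "F holomorphic_on ball (complex_of_real x) e"
    by (auto simp: analytic_on_def)
  have ev: "\<forall>\<^sub>F t in nhds x. complex_of_real t \<in> ball (complex_of_real x) r" if "r > 0" for r
  proof -
    have "\<forall>\<^sub>F z in nhds (complex_of_real x). z \<in> ball (complex_of_real x) r"
      using that by (intro eventually_nhds_in_open) auto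
    thus ?thesis using filterlim_of_real_nhds[of x] unfolding filterlim_iff by blast
  qed
  show ?thesis
  proof (cases "\<forall>w\<in>ball (complex_of_real x) e. F w = 0")
    case True
    from F(2) ev[OF e(1)] have "\<forall>\<^sub>F t in nhds x. f t = 0"
      by eventually_elim (use True in auto)
    thus ?thesis ..
  next
    case False
    define G where "G = zor_poly F (complex_of_real x)"
    define k where "k = nat (zorder F (complex_of_real x))"
    from zorder_exist_zero[OF e(2), of "complex_of_real x"] False e(1)
    obtain r where r: "r > 0" "G holomorphic_on cball (complex_of_real x) r"
       "\<forall>w\<in>cball (complex_of_real x) r. F w = G w * (w - complex_of_real x) ^ k \<and> G w \<noteq> 0"
      unfolding G_def k_def by auto
    have "G holomorphic_on ball (complex_of_real x) r"
      using r(2) by (rule holomorphic_on_subset) auto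
    hence "G analytic_on {complex_of_real x}"
      using r(1) by (auto simp: analytic_on_def)
    hence "real_analytic_at (\<lambda>t. G (complex_of_real t)) x"
      by (rule real_analytic_atI) auto
    moreover have "G (complex_of_real x) \<noteq> 0" using r by auto
    moreover from F(2) ev[OF r(1)]
    have "\<forall>\<^sub>F t in nhds x. f t = complex_of_real (t - x) ^ k * G (complex_of_real t)"
      by eventually_elim (use r(3) in \<open>auto simp: mult.commute\<close>)
    ultimately show ?thesis by blast
  qed
qed

lemma eventually_at_imp_eventually_nhds_at:
  fixes x :: real
  assumes "\<forall>\<^sub>F t in at x. P t"
  shows "\<forall>\<^sub>F y in nhds x. \<forall>\<^sub>F t in at y. P t"
proof -
  from assms obtain U where U: "open U" "x \<in> U" "\<And>t. t \<in> U \<Longrightarrow> t \<noteq> x \<Longrightarrow> P t"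
    unfolding eventually_at_topological by blast
  have "\<forall>\<^sub>F t in at y. P t" if "y \<in> U" for y
  proof (cases "y = x")
    case True
    thus ?thesis using assms by simp
  next
    case False
    have "open (U - {x})" using U by auto
    hence "\<forall>\<^sub>F t in at y. t \<in> U - {x}"
      using that False by (intro eventually_at_in_open') auto
    thus ?thesis by eventually_elim (use U in auto)
  qed
  thus ?thesis using U eventually_nhds by blast
qed

lemma open_if_eventually_nhds:
  assumes "\<And>x. x \<in> S \<Longrightarrow> \<forall>\<^sub>F t in nhds x. t \<in> S"
  shows "open S"
proof (subst open_subopen, intro ballI)
  fix x assume "x \<in> S"
  from assms[OF this] obtain U where "open U" "x \<in> U" "\<forall>t\<in>U. t \<in> S"
    unfolding eventually_nhds by blast
  thus "\<exists>T. open T \<and> x \<in> T \<and> T \<subseteq> S" by blast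
qed

text \<open>Carries an identity proved away from the isolated zeros of a divisor to the zeros
  themselves.\<close>

lemma isCont_eqI:
  fixes f g :: "real \<Rightarrow> complex"
  assumes "isCont f x" "isCont g x" "\<forall>\<^sub>F t in at x. f t = g t"
  shows "f x = g x"
proof -
  have "(f \<longlongrightarrow> g x) (at x)"
    using assms(2) tendsto_cong[OF assms(3)] by (simp add: isCont_def)
  thus ?thesis using assms(1) tendsto_unique[OF trivial_limit_at] by (simp add: isCont_def)
qed

text \<open>Points around which \<open>f\<close> vanishes and points that are at most isolated zeros
  form two disjoint open sets covering \<open>J\<close>; connectedness leaves only one. The
  conclusion is about \<open>at x\<close>, since \<open>x\<close> itself may be a zero.\<close>

lemma real_analytic_identity:
  assumes J: "open J" "connected J" and f: "\<And>x. x \<in> J \<Longrightarrow> real_analytic_at f x"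
    and nz: "t0 \<in> J" "f t0 \<noteq> 0" and x: "x \<in> J"
  shows "\<forall>\<^sub>F t in at x. f t \<noteq> 0"
proof -
  define A where "A = {x\<in>J. \<forall>\<^sub>F t in nhds x. f t = 0}"
  define B where "B = {x\<in>J. \<forall>\<^sub>F t in at x. f t \<noteq> 0}"
  have J': "\<forall>\<^sub>F t in nhds x. t \<in> J" if "x \<in> J" for x
    using J(1) that by (rule eventually_nhds_in_open)
  have "\<forall>\<^sub>F t in nhds x. t \<in> A" if "x \<in> A" for x
  proof -
    have "\<forall>\<^sub>F y in nhds x. \<forall>\<^sub>F t in nhds y. f t = 0"
      using that by (simp add: A_def eventually_eventually)
    moreover have "\<forall>\<^sub>F t in nhds x. t \<in> J" using that by (auto simp: A_def intro: J')
    ultimately show ?thesis by eventually_elim (auto simp: A_def)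
  qed
  hence "open A" by (rule open_if_eventually_nhds)
  have "\<forall>\<^sub>F t in nhds x. t \<in> B" if "x \<in> B" for x
  proof -
    have "\<forall>\<^sub>F y in nhds x. \<forall>\<^sub>F t in at y. f t \<noteq> 0"
      using that by (intro eventually_at_imp_eventually_nhds_at) (simp add: B_def)
    moreover have "\<forall>\<^sub>F t in nhds x. t \<in> J" using that by (auto simp: B_def intro: J')
    ultimately show ?thesis by eventually_elim (auto simp: B_def)
  qed
  hence "open B" by (rule open_if_eventually_nhds)
  have "x \<in> A \<or> x \<in> B" if "x \<in> J" for x
    using real_analytic_at_zero_or_factor[OF f[OF that]]
  proof
    assume "\<exists>k g. real_analytic_at g x \<and> g x \<noteq> 0 \<and>
        (\<forall>\<^sub>F t in nhds x. f t = complex_of_real (t - x) ^ k * g t)"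
    then obtain k g where g: "real_analytic_at g x" "g x \<noteq> 0"
        "\<forall>\<^sub>F t in nhds x. f t = complex_of_real (t - x) ^ k * g t" by blast
    have "\<forall>\<^sub>F t in at x. g t \<noteq> 0"
      using real_analytic_at_imp_isCont[OF g(1)] g(2)
      by (intro tendsto_imp_eventually_ne) (auto simp: isCont_def)
    moreover have "\<forall>\<^sub>F t in at x. f t = complex_of_real (t - x) ^ k * g t"
      using g(3) by (simp add: eventually_nhds_conv_at)
    moreover have "\<forall>\<^sub>F t in at x. t \<noteq> x" by (simp add: eventually_at_filter)
    ultimately have "\<forall>\<^sub>F t in at x. f t \<noteq> 0" by eventually_elim auto
    thus ?thesis using that by (simp add: B_def)
  qed (use that in \<open>simp add: A_def\<close>)
  hence cover: "J \<subseteq> A \<union> B" by blast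
  have "A \<inter> B = {}"
  proof (rule ccontr)
    assume "A \<inter> B \<noteq> {}"
    then obtain x where "\<forall>\<^sub>F t in at x. f t \<noteq> 0" "\<forall>\<^sub>F t in at x. f t = 0"
      by (auto simp: A_def B_def eventually_nhds_conv_at)
    hence "\<forall>\<^sub>F t in at x. False" by eventually_elim auto
    thus False by simp
  qed
  hence "A \<inter> J = {} \<or> B \<inter> J = {}"
    using connectedD[OF J(2) \<open>open A\<close> \<open>open B\<close>] cover by auto
  moreover have "t0 \<notin> A"
    using nz(2) by (auto simp: A_def dest: eventually_nhds_x_imp_x)
  hence "t0 \<in> B" using nz(1) cover by blast
  ultimately have "x \<in> B" using nz(1) x cover by blast
  thus ?thesis by (simp add: B_def)
qed

text \<open>The bound compares orders of vanishing: \<open>f\<close> vanishes to at least the order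
  of \<open>s\<close>, so the powers of \<open>t - x\<close> cancel.\<close>

lemma real_analytic_quotient_at:
  assumes f: "real_analytic_at f x" and s: "real_analytic_at s x" "\<forall>\<^sub>F t in at x. s t \<noteq> 0"
    and bd: "\<forall>\<^sub>F t in at x. norm (f t) \<le> K * norm (s t)"
  shows "\<exists>G. real_analytic_at G x \<and> (\<forall>\<^sub>F t in at x. f t / s t = G t)"
  using real_analytic_at_zero_or_factor[OF f]
proof
  assume "\<forall>\<^sub>F t in nhds x. f t = 0"
  hence "\<forall>\<^sub>F t in at x. f t / s t = 0"
    unfolding eventually_nhds_conv_at by (auto elim: eventually_mono)
  thus ?thesis by (intro exI[of _ "\<lambda>_. 0"]) auto
next
  assume "\<exists>k g. real_analytic_at g x \<and> g x \<noteq> 0 \<and>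
        (\<forall>\<^sub>F t in nhds x. f t = complex_of_real (t - x) ^ k * g t)"
  then obtain j g where g: "real_analytic_at g x" "g x \<noteq> 0"
        "\<forall>\<^sub>F t in nhds x. f t = complex_of_real (t - x) ^ j * g t" by blast
  have "\<not> (\<forall>\<^sub>F t in nhds x. s t = 0)"
  proof
    assume "\<forall>\<^sub>F t in nhds x. s t = 0"
    hence "\<forall>\<^sub>F t in at x. s t = 0" by (simp add: eventually_nhds_conv_at)
    with s(2) have "\<forall>\<^sub>F t in at x. False" by eventually_elim auto
    thus False by simp
  qed
  with real_analytic_at_zero_or_factor[OF s(1)] obtain k h where h: "real_analytic_at h x" "h x \<noteq> 0"
        "\<forall>\<^sub>F t in nhds x. s t = complex_of_real (t - x) ^ k * h t" by blast
  have f': "\<forall>\<^sub>F t in at x. f t = complex_of_real (t - x) ^ j * g t"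
    using g(3) by (simp add: eventually_nhds_conv_at)
  have s': "\<forall>\<^sub>F t in at x. s t = complex_of_real (t - x) ^ k * h t"
    using h(3) by (simp add: eventually_nhds_conv_at)
  have ne: "\<forall>\<^sub>F t in at x. t \<noteq> x" by (simp add: eventually_at_filter)
  have "k \<le> j"
  proof (rule ccontr)
    assume "\<not> k \<le> j"
    then obtain d where d: "k = j + Suc d" by (metis add_Suc_right less_imp_Suc_add not_le)
    \<comment> \<open>After division by the \<open>j\<close>-th power of the distance to
      \<open>x\<close>, the left side tends to \<open>norm (g x)\<close> and the right side, through
      its extra factor, to 0.\<close>
    from f' s' ne bd have "\<forall>\<^sub>F t in at x. norm (g t) \<le> K * (\<bar>t - x\<bar> ^ Suc d * norm (h t))"
    proof eventually_elim
      case (elim t)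
      hence "\<bar>t - x\<bar> ^ j * norm (g t) \<le> K * (\<bar>t - x\<bar> ^ (j + Suc d) * norm (h t))"
        by (simp add: norm_mult norm_power d flip: of_real_diff)
      also have "\<dots> = \<bar>t - x\<bar> ^ j * (K * (\<bar>t - x\<bar> ^ Suc d * norm (h t)))"
        by (simp add: power_add)
      finally show ?case using elim(3) by (simp only: mult_le_cancel_left_pos zero_less_power zero_less_abs_iff right_minus_eq not_False_eq_True)
    qed
    moreover have "((\<lambda>t. norm (g t)) \<longlongrightarrow> norm (g x)) (at x)"
      using real_analytic_at_imp_isCont[OF g(1)] by (intro tendsto_norm) (simp add: isCont_def)
    moreover have "((\<lambda>t. K * (\<bar>t - x\<bar> ^ Suc d * norm (h t))) \<longlongrightarrow> K * (\<bar>x - x\<bar> ^ Suc d * norm (h x))) (at x)"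
      using real_analytic_at_imp_isCont[OF h(1)] by (intro tendsto_intros) (simp add: isCont_def)
    ultimately have "norm (g x) \<le> K * (\<bar>x - x\<bar> ^ Suc d * norm (h x))"
      by (intro tendsto_le[OF trivial_limit_at])
    thus False using g(2) by simp
  qed
  then obtain d where d: "j = k + d" using le_Suc_ex by blast
  have "\<forall>\<^sub>F t in at x. f t / s t = complex_of_real (t - x) ^ d * (g t / h t)"
    using f' s' ne by eventually_elim (auto simp: d power_add)
  moreover have "real_analytic_at (\<lambda>t. complex_of_real (t - x) ^ d * (g t / h t)) x"
    unfolding of_real_diff using g h
    by (intro real_analytic_at_mult real_analytic_at_power real_analytic_at_diff real_analytic_at_divide) simp_all
  ultimately show ?thesis by (intro exI[of _ "\<lambda>t. complex_of_real (t - x) ^ d * (g t / h t)"]) blast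
qed

text \<open>The constant \<open>K\<close> may depend on \<open>x\<close>: local domination is
  enough, and the quotient may be unbounded towards the ends of \<open>J\<close>.\<close>

lemma real_analytic_division:
  assumes J: "open J" "connected J"
    and f: "\<And>x. x \<in> J \<Longrightarrow> real_analytic_at f x" and s: "\<And>x. x \<in> J \<Longrightarrow> real_analytic_at s x"
    and nz: "t0 \<in> J" "s t0 \<noteq> 0"
    and bd: "\<And>x. x \<in> J \<Longrightarrow> \<exists>K. \<forall>\<^sub>F t in at x. norm (f t) \<le> K * norm (s t)"
  shows "\<exists>q. (\<forall>x\<in>J. real_analytic_at q x) \<and> (\<forall>t\<in>J. f t = s t * q t)"
proof -
  \<comment> \<open>Taking limits fills in the zeros of \<open>s\<close> by one formula, so the
    local quotients \<open>G\<close> need not be glued.\<close>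
  define q where "q = (\<lambda>t. Lim (at t) (\<lambda>u. f u / s u))"
  have snz: "\<forall>\<^sub>F t in at x. s t \<noteq> 0" if "x \<in> J" for x
    using real_analytic_identity[OF J s nz that] by simp
  have loc: "\<exists>G. real_analytic_at G x \<and> (\<forall>\<^sub>F t in at x. f t / s t = G t) \<and> (\<forall>\<^sub>F t in nhds x. q t = G t)"
    if x: "x \<in> J" for x
  proof -
    from bd[OF x] obtain K where "\<forall>\<^sub>F t in at x. norm (f t) \<le> K * norm (s t)" by blast
    from real_analytic_quotient_at[OF f[OF x] s[OF x] snz[OF x] this]
    obtain G where G: "real_analytic_at G x" "\<forall>\<^sub>F t in at x. f t / s t = G t" by blast
    from eventually_at_imp_eventually_nhds_at[OF G(2)] eventually_real_analytic_at[OF G(1)]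
    have "\<forall>\<^sub>F t in nhds x. q t = G t"
    proof eventually_elim
      case (elim y)
      have "(G \<longlongrightarrow> G y) (at y)"
        using real_analytic_at_imp_isCont[OF elim(2)] by (simp add: isCont_def)
      hence "((\<lambda>u. f u / s u) \<longlongrightarrow> G y) (at y)"
        using tendsto_cong[OF elim(1)] by blast
      thus ?case unfolding q_def by (intro tendsto_Lim) auto
    qed
    with G show ?thesis by blast
  qed
  have q: "real_analytic_at q x" if "x \<in> J" for x
    using loc[OF that] real_analytic_at_transfer by blast
  moreover have "f t = s t * q t" if t: "t \<in> J" for t
  proof (rule isCont_eqI)
    show "isCont f t" "isCont (\<lambda>t. s t * q t) t"
      using f s q t by (auto intro!: real_analytic_at_imp_isCont real_analytic_at_mult)
    from loc[OF t] obtain G where G: "\<forall>\<^sub>F t in at t. f t / s t = G t" "\<forall>\<^sub>F t in at t. q t = G t"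
      by (auto simp: eventually_nhds_conv_at)
    from G snz[OF t] show "\<forall>\<^sub>F t in at t. f t = s t * q t"
      by eventually_elim (auto simp: field_simps)
  qed
  ultimately show ?thesis by blast
qed

section \<open>Square roots of nonnegative analytic functions\<close>

lemma nonneg_Reals_tendsto:
  fixes f :: "'a \<Rightarrow> complex"
  assumes "(f \<longlongrightarrow> l) F" "\<forall>\<^sub>F t in F. f t \<in> \<real>\<^sub>\<ge>\<^sub>0" "F \<noteq> bot"
  shows "l \<in> \<real>\<^sub>\<ge>\<^sub>0"
  using Lim_in_closed_set[OF closed_nonneg_Reals_complex assms(2,3,1)] .

text \<open>Positivity to the right of \<open>x\<close> makes \<open>g x\<close> positive, and
  positivity to the left then makes \<open>k\<close> even, say \<open>2 * m\<close>. So the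
  principal root is \<open>|t - x| ^ m\<close> times an analytic function; for odd \<open>m\<close>
  a sign flip at \<open>x\<close> turns the first factor into \<open>(t - x) ^ m\<close>.\<close>

lemma real_analytic_sqrt_at:
  assumes f: "real_analytic_at f x" and nn: "\<forall>\<^sub>F t in nhds x. f t \<in> \<real>\<^sub>\<ge>\<^sub>0"
  shows "real_analytic_at (\<lambda>t. csqrt (f t)) x \<or>
         real_analytic_at (\<lambda>t. (if t \<le> x then -1 else 1) * csqrt (f t)) x"
  using real_analytic_at_zero_or_factor[OF f]
proof
  assume "\<forall>\<^sub>F t in nhds x. f t = 0"
  hence "\<forall>\<^sub>F t in nhds x. csqrt (f t) = 0" by eventually_elim simp
  from real_analytic_at_cong[OF this] show ?thesis by simp
next
  assume "\<exists>k g. real_analytic_at g x \<and> g x \<noteq> 0 \<and>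
        (\<forall>\<^sub>F t in nhds x. f t = complex_of_real (t - x) ^ k * g t)"
  then obtain k g where g: "real_analytic_at g x" "g x \<noteq> 0"
        "\<forall>\<^sub>F t in nhds x. f t = complex_of_real (t - x) ^ k * g t" by blast
  have lim: "(g \<longlongrightarrow> g x) (at_right x)" "(g \<longlongrightarrow> g x) (at_left x)"
    using real_analytic_at_imp_isCont[OF g(1)] by (auto simp: isCont_def filterlim_at_split)
  have div: "g t = f t * complex_of_real (inverse ((t - x) ^ k))"
    if "f t = complex_of_real (t - x) ^ k * g t" "t \<noteq> x" for t
    using that by (simp add: field_simps flip: of_real_diff)
  have right: "\<forall>\<^sub>F t in at_right x. f t \<in> \<real>\<^sub>\<ge>\<^sub>0" "\<forall>\<^sub>F t in at_right x. f t = complex_of_real (t - x) ^ k * g t"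
    and left: "\<forall>\<^sub>F t in at_left x. f t \<in> \<real>\<^sub>\<ge>\<^sub>0" "\<forall>\<^sub>F t in at_left x. f t = complex_of_real (t - x) ^ k * g t"
    using nn g(3) by (auto simp: eventually_nhds_conv_at eventually_at_split)
  have "\<forall>\<^sub>F t in at_right x. g t \<in> \<real>\<^sub>\<ge>\<^sub>0"
    using right eventually_at_right_less[of x]
  proof eventually_elim
    case (elim t)
    hence "complex_of_real (inverse ((t - x) ^ k)) \<in> \<real>\<^sub>\<ge>\<^sub>0"
      by (simp only: nonneg_Reals_of_real_iff) simp
    thus ?case using elim div[of t] by (metis less_irrefl nonneg_Reals_mult_I)
  qed
  hence gx: "g x \<in> \<real>\<^sub>\<ge>\<^sub>0"
    using lim(1) by (intro nonneg_Reals_tendsto) auto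
  \<comment> \<open>A strictly positive \<open>g x\<close> lies off the branch cut, so
    \<open>csqrt (g t)\<close> is analytic near \<open>x\<close>.\<close>
  hence gx': "g x \<notin> \<real>\<^sub>\<le>\<^sub>0"
    using g(2) by (auto simp: complex_nonneg_Reals_iff complex_nonpos_Reals_iff complex_eq_iff)
  have "even k"
  proof (rule ccontr)
    assume "odd k"
    have "\<forall>\<^sub>F t in at_left x. t < x"
      by (simp add: eventually_at_filter)
    with left have "\<forall>\<^sub>F t in at_left x. - g t \<in> \<real>\<^sub>\<ge>\<^sub>0"
    proof eventually_elim
      case (elim t)
      hence "- g t = f t * complex_of_real (- inverse ((t - x) ^ k))"
        using div[of t] by simp
      also have "\<dots> \<in> \<real>\<^sub>\<ge>\<^sub>0"
        using elim \<open>odd k\<close>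
        by (intro nonneg_Reals_mult_I, simp, simp only: nonneg_Reals_of_real_iff)
          (simp add: power_le_zero_eq odd_pos)
      finally show ?case .
    qed
    hence "- g x \<in> \<real>\<^sub>\<ge>\<^sub>0"
      using lim(2) by (intro nonneg_Reals_tendsto[where F = "at_left x" and f = "\<lambda>t. - g t"] tendsto_minus) auto
    thus False using gx g(2) by (auto simp: complex_nonneg_Reals_iff complex_eq_iff)
  qed
  then obtain m where m: "k = 2 * m" by blast
  have "\<forall>\<^sub>F t in nhds x. csqrt (f t) = complex_of_real (\<bar>t - x\<bar> ^ m) * csqrt (g t)"
    using nn g(3)
  proof eventually_elim
    case (elim t)
    have "g t \<in> \<real>\<^sub>\<ge>\<^sub>0"
    proof (cases "t = x")
      case False
      have "complex_of_real (inverse ((t - x) ^ k)) \<in> \<real>\<^sub>\<ge>\<^sub>0"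
        by (simp only: nonneg_Reals_of_real_iff) (simp add: m power_mult)
      thus ?thesis using elim div[of t] False by (metis nonneg_Reals_mult_I)
    qed (use gx in simp)
    then obtain c where c: "g t = complex_of_real c" "c \<ge> 0" by (auto elim: nonneg_Reals_cases)
    have "(\<bar>t - x\<bar> ^ m)\<^sup>2 = (t - x) ^ k"
      by (simp only: m power_even_eq[symmetric]) (simp only: power_even_abs even_mult_iff even_numeral simp_thms)
    hence "f t = complex_of_real ((\<bar>t - x\<bar> ^ m)\<^sup>2 * c)"
      by (simp only: elim c of_real_mult of_real_power)
    hence "csqrt (f t) = complex_of_real (sqrt ((\<bar>t - x\<bar> ^ m)\<^sup>2 * c))"
      using c(2) of_real_sqrt[of "(\<bar>t - x\<bar> ^ m)\<^sup>2 * c"] by (simp only: zero_le_mult_iff zero_le_power2 simp_thms)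
    also have "\<dots> = complex_of_real (\<bar>t - x\<bar> ^ m * sqrt c)"
      by (simp add: real_sqrt_mult)
    also have "\<dots> = complex_of_real (\<bar>t - x\<bar> ^ m) * csqrt (g t)"
      using of_real_sqrt[OF c(2)] by (simp only: c(1) of_real_mult)
    finally show ?case .
  qed
  note csqrt_f = this
  have an: "real_analytic_at (\<lambda>t. complex_of_real (t - x) ^ m * csqrt (g t)) x"
    unfolding of_real_diff using g(1) gx'
    by (intro real_analytic_at_mult real_analytic_at_power real_analytic_at_diff real_analytic_at_csqrt) simp_all
  show ?thesis
  proof (cases "even m")
    case True
    from csqrt_f have "\<forall>\<^sub>F t in nhds x. csqrt (f t) = complex_of_real (t - x) ^ m * csqrt (g t)"
      by eventually_elim (use True in \<open>simp add: power_even_abs\<close>)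
    from real_analytic_at_transfer[OF an this] show ?thesis ..
  next
    case False
    from csqrt_f have "\<forall>\<^sub>F t in nhds x. (if t \<le> x then -1 else 1) * csqrt (f t) = complex_of_real (t - x) ^ m * csqrt (g t)"
    proof eventually_elim
      case (elim t)
      have "(if t \<le> x then -1 else 1) * \<bar>t - x\<bar> ^ m = (t - x) ^ m"
        using False by (cases "t \<le> x") (simp_all add: power_minus_odd[symmetric])
      hence "complex_of_real ((if t \<le> x then -1 else 1) * \<bar>t - x\<bar> ^ m) = complex_of_real (t - x) ^ m"
        by (simp only: of_real_power)
      hence "(if t \<le> x then -1 else 1) * complex_of_real (\<bar>t - x\<bar> ^ m) = complex_of_real (t - x) ^ m"
        by (simp only: of_real_mult if_distrib[of complex_of_real] of_real_minus of_real_1)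
      thus ?case by (simp only: elim mult.assoc[symmetric])
    qed
    from real_analytic_at_transfer[OF an this] show ?thesis ..
  qed
qed

text \<open>Sign changes are required exactly at a discrete set \<open>Z\<close>, and the sign at
  \<open>t\<close> is the parity of the number of points of \<open>Z\<close> between a base point
  and \<open>t\<close>. Finiteness on compact subintervals suffices, so \<open>Z\<close> may
  accumulate at the ends of \<open>J\<close>.\<close>

lemma real_analytic_sign_patching:
  assumes J: "open J" "connected J"
    and r: "\<And>x. x \<in> J \<Longrightarrow> real_analytic_at r x \<or>
              real_analytic_at (\<lambda>t. (if t \<le> x then -1 else 1) * r t) x"
  shows "\<exists>\<sigma> :: real \<Rightarrow> real. (\<forall>t. (\<sigma> t)\<^sup>2 = 1) \<and> (\<forall>x\<in>J. real_analytic_at (\<lambda>t. complex_of_real (\<sigma> t) * r t) x)"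
proof (cases "J = {}")
  case True
  thus ?thesis by (intro exI[of _ "\<lambda>_. 1"]) auto
next
  case False
  then obtain t0 where t0: "t0 \<in> J" by blast
  define Z where "Z = {x\<in>J. \<not> real_analytic_at r x}"
  have isol: "\<forall>\<^sub>F t in at x. t \<notin> Z" if "x \<in> J" for x
    using r[OF that]
  proof
    assume "real_analytic_at r x"
    from eventually_real_analytic_at[OF this] show ?thesis
      by (auto simp: eventually_nhds_conv_at Z_def elim: eventually_mono)
  next
    let ?r = "\<lambda>t. (if t \<le> x then -1 else 1) * r t"
    assume "real_analytic_at ?r x"
    from eventually_real_analytic_at[OF this]
    have "\<forall>\<^sub>F t in at x. real_analytic_at ?r t" by (simp add: eventually_nhds_conv_at)
    moreover have "\<forall>\<^sub>F t in at x. t \<noteq> x" by (simp add: eventually_at_filter)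
    ultimately show ?thesis
    proof eventually_elim
      case (elim t)
      \<comment> \<open>Away from \<open>x\<close> the flipping factor is locally constant, so
        \<open>r\<close> itself is analytic at \<open>t\<close>.\<close>
      have "\<forall>\<^sub>F u in nhds t. u \<in> (if t < x then {..<x} else {x<..})"
        using elim by (intro eventually_nhds_in_open) auto
      hence "\<forall>\<^sub>F u in nhds t. (if t < x then -1 else 1) * ?r u = r u"
        by eventually_elim (auto split: if_splits)
      note * = this
      have "real_analytic_at (\<lambda>u. (if t < x then -1 else 1) * ?r u) t"
        using elim(1) by (intro real_analytic_at_mult[of "\<lambda>_. if t < x then -1 else 1" t ?r] real_analytic_at_const)
      with * have "real_analytic_at r t" by (simp only: real_analytic_at_cong)
      thus ?case by (simp add: Z_def)
    qed
  qed
  have fin: "finite (Z \<inter> {a..<b})" if "a \<in> J" "b \<in> J" for a b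
  proof -
    have sub: "{a..b} \<subseteq> J" using connected_contains_Icc[OF J(2)] that by blast
    have "finite ({a..b} \<inter> Z)"
      using sub isol by (intro finite_not_islimpt_in_compact) (auto simp: islimpt_iff_eventually)
    thus ?thesis by (rule finite_subset[rotated]) auto
  qed
  \<comment> \<open>Half-open intervals make the count additive and place the flip at a point of
    \<open>Z\<close> strictly to its right, which matches the condition \<open>t \<le> x\<close> in
    the hypothesis.\<close>
  define N where "N = (\<lambda>a b. card (Z \<inter> {a..<b}))"
  have N: "N a c = N a b + N b c" if "a \<le> b" "b \<le> c" "a \<in> J" "b \<in> J" "c \<in> J" for a b c
  proof -
    have "Z \<inter> {a..<c} = (Z \<inter> {a..<b}) \<union> (Z \<inter> {b..<c})" using that by auto
    moreover have "(Z \<inter> {a..<b}) \<inter> (Z \<inter> {b..<c}) = {}" by auto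
    ultimately show ?thesis unfolding N_def using fin that by (simp add: card_Un_disjoint)
  qed
  define \<sigma> :: "real \<Rightarrow> real" where "\<sigma> = (\<lambda>t. if t0 \<le> t then (-1) ^ N t0 t else (-1) ^ N t t0)"
  have sq: "(\<sigma> t)\<^sup>2 = 1" for t by (simp add: \<sigma>_def flip: power_mult)
  \<comment> \<open>Comparing two points directly removes the base point \<open>t0\<close> from the
    local analysis at \<open>x\<close>.\<close>
  have step: "\<sigma> b = \<sigma> a * (-1) ^ N a b" if "a \<le> b" "a \<in> J" "b \<in> J" for a b
  proof -
    have sg: "((-1) ^ n) * ((-1) ^ n) = (1::real)" for n :: nat
      by (simp flip: power_add)
    consider "t0 \<le> a" | "a < t0" "t0 \<le> b" | "b < t0" using that by linarith
    thus ?thesis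
    proof cases
      case 1
      with N[of t0 a b] that t0 show ?thesis by (simp add: \<sigma>_def power_add)
    next
      case 2
      with N[of a t0 b] that t0 show ?thesis by (simp add: \<sigma>_def power_add sg flip: mult.assoc)
    next
      case 3
      with N[of a b t0] that t0 show ?thesis by (simp add: \<sigma>_def power_add sg mult_ac)
    qed
  qed
  have "real_analytic_at (\<lambda>t. complex_of_real (\<sigma> t) * r t) x" if x: "x \<in> J" for x
  proof -
    obtain e1 where e1: "e1 > 0" "\<And>t. t \<noteq> x \<Longrightarrow> dist t x < e1 \<Longrightarrow> t \<notin> Z"
      using isol[OF x] by (auto simp: eventually_at)
    obtain e2 where e2: "e2 > 0" "ball x e2 \<subseteq> J" using J(1) x by (auto simp: open_contains_ball)
    have ev: "\<forall>\<^sub>F t in nhds x. t \<in> ball x (min e1 e2)"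
      using e1 e2 by (intro eventually_nhds_in_open) auto
    have sgn: "\<sigma> t = (if t \<le> x then \<sigma> x else \<sigma> x * (if x \<in> Z then -1 else 1))"
      if t: "t \<in> ball x (min e1 e2)" for t
    proof -
      have tJ: "t \<in> J" using t e2 by auto
      show ?thesis
      proof (cases "t \<le> x")
        case True
        have "Z \<inter> {t..<x} = {}" using e1(2) t by (force simp: dist_real_def)
        thus ?thesis using step[OF True tJ x] True by (simp add: N_def)
      next
        case False
        have "Z \<inter> {x..<t} = (if x \<in> Z then {x} else {})" 
          using e1(2) t False by (force simp: dist_real_def)
        thus ?thesis using step[of x t] False tJ x by (auto simp: N_def)
      qed
    qed
    show ?thesis
    proof (cases "x \<in> Z")
      case False
      hence "real_analytic_at (\<lambda>t. complex_of_real (\<sigma> x) * r t) x"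
        using x by (intro real_analytic_at_mult) (auto simp: Z_def)
      note * = this
      from ev have "\<forall>\<^sub>F t in nhds x. complex_of_real (\<sigma> t) * r t = complex_of_real (\<sigma> x) * r t"
        by eventually_elim (use False sgn in auto)
      with * show ?thesis by (rule real_analytic_at_transfer)
    next
      case True
      \<comment> \<open>The factor \<open>- \<sigma> x\<close> compensates the -1 that the
        hypothesis places to the left of \<open>x\<close>.\<close>
      hence "real_analytic_at (\<lambda>t. complex_of_real (- \<sigma> x) * ((if t \<le> x then -1 else 1) * r t)) x"
        using r[OF x] x
        by (intro real_analytic_at_mult[OF real_analytic_at_const]) (auto simp: Z_def)
      note * = this
      from ev have "\<forall>\<^sub>F t in nhds x. complex_of_real (\<sigma> t) * r t = complex_of_real (- \<sigma> x) * ((if t \<le> x then -1 else 1) * r t)"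
        by eventually_elim (use True sgn in auto)
      with * show ?thesis by (rule real_analytic_at_transfer)
    qed
  qed
  with sq show ?thesis by blast
qed

text \<open>The root is real but may be negative, since a nonnegative root can have corners at its
  zeros. Being real, it satisfies \<open>s t * cnj (s t) = f t\<close>, as a diagonal Cholesky entry
  must.\<close>

lemma real_analytic_sqrt:
  assumes J: "open J" "connected J" and f: "\<And>x. x \<in> J \<Longrightarrow> real_analytic_at f x"
    and nn: "\<And>x. x \<in> J \<Longrightarrow> f x \<in> \<real>\<^sub>\<ge>\<^sub>0"
  shows "\<exists>s. (\<forall>x\<in>J. real_analytic_at s x) \<and> (\<forall>t\<in>J. s t \<in> \<real> \<and> s t * s t = f t)"
proof -
  have "real_analytic_at (\<lambda>t. csqrt (f t)) x \<or>
         real_analytic_at (\<lambda>t. (if t \<le> x then -1 else 1) * csqrt (f t)) x" if "x \<in> J" for x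
  proof (rule real_analytic_sqrt_at[OF f[OF that]])
    have "\<forall>\<^sub>F t in nhds x. t \<in> J" using J(1) that by (rule eventually_nhds_in_open)
    thus "\<forall>\<^sub>F t in nhds x. f t \<in> \<real>\<^sub>\<ge>\<^sub>0" by eventually_elim (rule nn)
  qed
  from real_analytic_sign_patching[OF J this]
  obtain \<sigma> :: "real \<Rightarrow> real" where \<sigma>: "\<And>t. (\<sigma> t)\<^sup>2 = 1"
    "\<And>x. x \<in> J \<Longrightarrow> real_analytic_at (\<lambda>t. complex_of_real (\<sigma> t) * csqrt (f t)) x" by blast
  have "complex_of_real (\<sigma> t) * csqrt (f t) \<in> \<real> \<and>
        complex_of_real (\<sigma> t) * csqrt (f t) * (complex_of_real (\<sigma> t) * csqrt (f t)) = f t"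
    if "t \<in> J" for t
  proof -
    from nn[OF that] obtain c where c: "f t = complex_of_real c" "c \<ge> 0" by (auto elim: nonneg_Reals_cases)
    have "complex_of_real (\<sigma> t) * csqrt (f t) * (complex_of_real (\<sigma> t) * csqrt (f t)) =
       complex_of_real ((\<sigma> t)\<^sup>2) * (csqrt (f t))\<^sup>2" by (simp add: power2_eq_square)
    also have "\<dots> = f t" by (simp add: \<sigma>(1))
    finally have "complex_of_real (\<sigma> t) * csqrt (f t) * (complex_of_real (\<sigma> t) * csqrt (f t)) = f t" .
    moreover have "csqrt (f t) \<in> \<real>"
      unfolding c(1) of_real_sqrt[OF c(2), symmetric] by simp
    ultimately show ?thesis by (simp add: Reals_mult)
  qed
  with \<sigma>(2) show ?thesis by (intro exI[of _ "\<lambda>t. complex_of_real (\<sigma> t) * csqrt (f t)"]) blast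
qed

section \<open>Analytic Cholesky factorization\<close>

text \<open>Indexed by all naturals with a separate size, so that a leading block is the same
  function with a smaller \<open>d\<close>. Membership in the nonnegative reals includes reality of
  the form, from which Hermitian symmetry follows.\<close>

definition psd_form :: "nat \<Rightarrow> (nat \<Rightarrow> nat \<Rightarrow> complex) \<Rightarrow> bool" where
  "psd_form d A \<longleftrightarrow> (\<forall>v. (\<Sum>i<d. \<Sum>j<d. cnj (v i) * A i j * v j) \<in> \<real>\<^sub>\<ge>\<^sub>0)"

lemma psd_formD:
  "psd_form d A \<Longrightarrow> (\<Sum>i<d. \<Sum>j<d. cnj (v i) * A i j * v j) \<in> \<real>\<^sub>\<ge>\<^sub>0"
  by (simp add: psd_form_def)

lemma psd_form_Suc:
  assumes "psd_form (Suc d) A"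
  shows "psd_form d A"
  unfolding psd_form_def
proof
  fix v
  have "(\<Sum>i<Suc d. \<Sum>j<Suc d. cnj (if i < d then v i else 0) * A i j * (if j < d then v j else 0)) \<in> \<real>\<^sub>\<ge>\<^sub>0"
    using assms unfolding psd_form_def by (rule spec)
  thus "(\<Sum>i<d. \<Sum>j<d. cnj (v i) * A i j * v j) \<in> \<real>\<^sub>\<ge>\<^sub>0"
    by simp
qed

text \<open>Test vectors supported on two indices are all that Hermitian symmetry and Cauchy-Schwarz
  require.\<close>

lemma psd_form_two:
  assumes "psd_form d A" "i < d" "j < d" "i \<noteq> j"
  shows "cnj x * A i i * x + cnj x * A i j * y + (cnj y * A j i * x + cnj y * A j j * y) \<in> \<real>\<^sub>\<ge>\<^sub>0"
proof -
  define v where "v = (\<lambda>k. if k = i then x else if k = j then y else 0)"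
  have inner: "(\<Sum>b<d. cnj (v a) * A a b * v b) = cnj (v a) * A a i * x + cnj (v a) * A a j * y" for a
  proof -
    have "(\<Sum>b<d. cnj (v a) * A a b * v b) = (\<Sum>b\<in>{i, j}. cnj (v a) * A a b * v b)"
      using assms by (intro sum.mono_neutral_right) (auto simp: v_def)
    thus ?thesis using assms(4) by (simp add: v_def)
  qed
  have "(\<Sum>a<d. \<Sum>b<d. cnj (v a) * A a b * v b) = (\<Sum>a\<in>{i, j}. cnj (v a) * A a i * x + cnj (v a) * A a j * y)"
    unfolding inner using assms by (intro sum.mono_neutral_right) (auto simp: v_def)
  also have "\<dots> = cnj x * A i i * x + cnj x * A i j * y + (cnj y * A j i * x + cnj y * A j j * y)"
    using assms(4) by (simp add: v_def)
  finally show ?thesis using psd_formD[OF assms(1), of v] by (simp only:)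
qed

lemma psd_form_diag:
  assumes "psd_form d A" "i < d"
  shows "A i i \<in> \<real>\<^sub>\<ge>\<^sub>0"
proof -
  define v :: "nat \<Rightarrow> complex" where "v = (\<lambda>k. if k = i then 1 else 0)"
  have "(\<Sum>a<d. \<Sum>b<d. cnj (v a) * A a b * v b) = (\<Sum>a\<in>{i}. \<Sum>b<d. cnj (v a) * A a b * v b)"
    using assms by (intro sum.mono_neutral_right) (auto simp: v_def)
  also have "\<dots> = (\<Sum>b\<in>{i}. A i b * v b)"
    using assms by (simp add: v_def mult_delta_right)
  finally have "(\<Sum>a<d. \<Sum>b<d. cnj (v a) * A a b * v b) = A i i" by (simp add: v_def)
  thus ?thesis using psd_formD[OF assms(1), of v] by (simp only:)
qed

text \<open>Polarization: reality of the form at \<open>(1, 1)\<close> makes the imaginary parts of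
  the two entries opposite, and reality at \<open>(1, \<i>)\<close> makes their real parts
  equal.\<close>

lemma psd_form_hermitian:
  assumes "psd_form d A" "i < d" "j < d"
  shows "A j i = cnj (A i j)"
proof (cases "i = j")
  case True
  thus ?thesis using psd_form_diag[OF assms(1,2)] by (auto elim: nonneg_Reals_cases)
next
  case False
  have "Im (A i i) = 0" "Im (A j j) = 0"
    using psd_form_diag[OF assms(1)] assms by (auto simp: complex_nonneg_Reals_iff)
  moreover have "Im (A i i + A i j + (A j i + A j j)) = 0"
    using psd_form_two[OF assms False, of 1 1] by (simp add: complex_nonneg_Reals_iff)
  moreover have "Im (A i i + A i j * \<i> + (- \<i> * A j i + A j j)) = 0"
    using psd_form_two[OF assms False, of 1 \<i>] by (simp add: complex_nonneg_Reals_iff)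
  ultimately show ?thesis by (simp add: complex_eq_iff)
qed

lemma psd_form_cauchy_schwarz:
  assumes "psd_form d A" "i < d" "j < d"
  shows "(cmod (A i j))\<^sup>2 \<le> Re (A i i) * Re (A j j)"
proof (cases "i = j")
  case True
  thus ?thesis using psd_form_diag[OF assms(1,2)] 
    by (auto simp: complex_nonneg_Reals_iff cmod_eq_Re power2_eq_square)
next
  case False
  define p q c where "p = Re (A i i)" and "q = Re (A j j)" and "c = A i j"
  have A: "A i i = complex_of_real p" "A j j = complex_of_real q" and p: "p \<ge> 0" and q: "q \<ge> 0"
    using psd_form_diag[OF assms(1)] assms by (auto simp: complex_nonneg_Reals_iff p_def q_def complex_eq_iff)
  have Aji: "A j i = cnj c" using psd_form_hermitian[OF assms] by (simp add: c_def)
  \<comment> \<open>The test vector \<open>(l * c, m)\<close> with real \<open>l\<close> and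
    \<open>m\<close> removes the phase of \<open>c\<close> and leaves a real quadratic form.\<close>
  have key: "0 \<le> l\<^sup>2 * (cmod c)\<^sup>2 * p + 2 * l * m * (cmod c)\<^sup>2 + m\<^sup>2 * q" for l m :: real
  proof -
    have "cnj (l * c) * A i i * (l * c) + cnj (l * c) * A i j * m + (cnj m * A j i * (l * c) + cnj m * A j j * m)
      = complex_of_real (l\<^sup>2 * p) * (c * cnj c) + complex_of_real (2 * l * m) * (c * cnj c) + complex_of_real (m\<^sup>2 * q)"
      by (simp add: A Aji c_def[symmetric] algebra_simps power2_eq_square)
    also have "\<dots> = complex_of_real (l\<^sup>2 * p * (cmod c)\<^sup>2 + 2 * l * m * (cmod c)\<^sup>2 + m\<^sup>2 * q)"
      by (simp only: complex_norm_square[symmetric] of_real_add of_real_mult of_real_power)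
    finally have "complex_of_real (l\<^sup>2 * p * (cmod c)\<^sup>2 + 2 * l * m * (cmod c)\<^sup>2 + m\<^sup>2 * q) \<in> \<real>\<^sub>\<ge>\<^sub>0"
      using psd_form_two[OF assms False, of "l * c" m] by simp
    thus ?thesis by (simp only: nonneg_Reals_of_real_iff) (simp add: mult_ac)
  qed
  have "(cmod c)\<^sup>2 \<le> p * q"
  proof (cases "p = 0")
    case True
    have "(cmod c)\<^sup>2 = 0"
    proof (rule ccontr)
      assume "(cmod c)\<^sup>2 \<noteq> 0"
      \<comment> \<open>With these values the form equals \<open>- q - 2\<close>, which is
        negative.\<close>
      with key[of "(q + 1) / (cmod c)\<^sup>2" "-1"] True q show False by simp
    qed
    thus ?thesis using True by simp
  next
    case False
    \<comment> \<open>For positive \<open>p\<close> the form is minimal in \<open>l\<close> at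
      \<open>l = - m / p\<close>; taking \<open>l = 1\<close> and \<open>m = - p\<close> clears the
      denominator.\<close>
    have "0 \<le> p * (p * q - (cmod c)\<^sup>2)"
      using key[of 1 "- p"] by (simp add: algebra_simps power2_eq_square)
    thus ?thesis using False p by (simp add: zero_le_mult_iff)
  qed
  thus ?thesis by (simp add: p_def q_def c_def)
qed

lemma psd_form_schur_complement:
  assumes A: "psd_form (Suc d) A" and a: "A d d \<noteq> 0"
  shows "psd_form d (\<lambda>i j. A i j - A i d * A d j / A d d)"
  unfolding psd_form_def
proof
  fix v :: "nat \<Rightarrow> complex"
  define w where "w = (\<Sum>j<d. A d j * v j)"
  \<comment> \<open>The last coordinate minimizes the form over all extensions of \<open>v\<close>;
    the minimum is the form of the Schur complement.\<close>
  define u where "u = (\<lambda>i. if i < d then v i else - w / A d d)"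
  have w: "(\<Sum>i<d. cnj (v i) * A i d) = cnj w"
    unfolding w_def cnj_sum
  proof (intro sum.cong refl)
    fix i assume "i \<in> {..<d}"
    thus "cnj (v i) * A i d = cnj (A d i * v i)"
      using psd_form_hermitian[OF A, of d i] by simp
  qed
  have block: "(\<Sum>i<Suc d. \<Sum>j<Suc d. c i * A i j * e j) =
      (\<Sum>i<d. \<Sum>j<d. c i * A i j * e j) + (\<Sum>i<d. c i * A i d) * e d
      + (c d * (\<Sum>j<d. A d j * e j) + c d * A d d * e d)" for c e :: "nat \<Rightarrow> complex"
    by (simp add: sum.distrib sum_distrib_left sum_distrib_right mult.assoc)
  have u: "u i = v i" if "i < d" for i using that by (simp add: u_def)
  have ud: "u d = - w / A d d" by (simp add: u_def)
  have "P + cnj w * (- w / A d d) + (cnj (- w / A d d) * w + cnj (- w / A d d) * A d d * (- w / A d d))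
      = P - cnj w * w / A d d" for P
    using a by simp
  hence "(\<Sum>i<Suc d. \<Sum>j<Suc d. cnj (u i) * A i j * u j) =
      (\<Sum>i<d. \<Sum>j<d. cnj (v i) * A i j * v j) - cnj w * w / A d d"
    unfolding block[of "\<lambda>i. cnj (u i)" u] ud using w by (simp add: u w_def)
  also have "cnj w * w / A d d = (\<Sum>i<d. \<Sum>j<d. cnj (v i) * (A i d * A d j / A d d) * v j)"
    unfolding w[symmetric] unfolding w_def sum_product sum_divide_distrib
    by (intro sum.cong refl) simp
  also have "(\<Sum>i<d. \<Sum>j<d. cnj (v i) * A i j * v j) - \<dots> =
      (\<Sum>i<d. \<Sum>j<d. cnj (v i) * (A i j - A i d * A d j / A d d) * v j)"
    by (simp only: sum_subtractf[symmetric] right_diff_distrib left_diff_distrib)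
  finally have "(\<Sum>i<d. \<Sum>j<d. cnj (v i) * (A i j - A i d * A d j / A d d) * v j) =
    (\<Sum>i<Suc d. \<Sum>j<Suc d. cnj (u i) * A i j * u j)" by (rule sym)
  moreover have "(\<Sum>i<Suc d. \<Sum>j<Suc d. cnj (u i) * A i j * u j) \<in> \<real>\<^sub>\<ge>\<^sub>0"
    using A unfolding psd_form_def by (rule spec)
  ultimately show "(\<Sum>i<d. \<Sum>j<d. cnj (v i) * (A i j - A i d * A d j / A d d) * v j) \<in> \<real>\<^sub>\<ge>\<^sub>0"
    by (simp only:)
qed

text \<open>One elimination step. The pivot is the last index, so that the remaining block keeps its
  indices. A pivot that is not identically zero has isolated zeros; an identically zero one forces
  its whole column to vanish.\<close>

lemma analytic_pivot_column:
  assumes J: "open J" "connected J"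
    and an: "\<And>x i j. x \<in> J \<Longrightarrow> i < Suc d \<Longrightarrow> j < Suc d \<Longrightarrow> real_analytic_at (\<lambda>t. A t i j) x"
    and psd: "\<And>t. t \<in> J \<Longrightarrow> psd_form (Suc d) (A t)"
  shows "\<exists>l. (\<forall>x\<in>J. \<forall>i<Suc d. real_analytic_at (\<lambda>t. l t i) x) \<and>
    (\<forall>t\<in>J. \<forall>i<Suc d. A t i d = l t i * cnj (l t d)) \<and>
    (\<forall>t\<in>J. psd_form d (\<lambda>i j. A t i j - l t i * cnj (l t j)))"
proof (cases "\<forall>t\<in>J. A t d d = 0")
  case True
  have "A t i d = 0" if "t \<in> J" "i < Suc d" for t i
    using psd_form_cauchy_schwarz[OF psd[OF that(1)] that(2), of d] True that by simp
  thus ?thesis using psd_form_Suc[OF psd]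
    by (intro exI[of _ "\<lambda>_ _. 0"]) auto
next
  case False
  then obtain t0 where t0: "t0 \<in> J" "A t0 d d \<noteq> 0" by blast
  obtain s where s: "\<And>x. x \<in> J \<Longrightarrow> real_analytic_at s x" "\<And>t. t \<in> J \<Longrightarrow> s t \<in> \<real>"
      "\<And>t. t \<in> J \<Longrightarrow> s t * s t = A t d d"
    using real_analytic_sqrt[OF J, of "\<lambda>t. A t d d"] an psd_form_diag[OF psd, of _ d] by (metis lessI)
  have s0: "s t0 \<noteq> 0" using s(3)[OF t0(1)] t0(2) by auto
  have cs: "cnj (s t) = s t" if "t \<in> J" for t using s(2)[OF that] by (simp add: Reals_cnj_iff)
  have "\<exists>q. (\<forall>x\<in>J. real_analytic_at q x) \<and> (\<forall>t\<in>J. A t i d = s t * q t)" if i: "i < d" for i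
  proof (rule real_analytic_division[OF J _ s(1) t0(1) s0])
    fix x assume x: "x \<in> J"
    \<comment> \<open>A local bound on the diagonal entry turns Cauchy-Schwarz into domination of
      the column by \<open>s\<close>.\<close>
    have "isCont (\<lambda>t. norm (A t i i)) x"
      using real_analytic_at_imp_isCont[OF an[OF x, of i i]] i by simp
    hence "\<forall>\<^sub>F t in at x. norm (A t i i) < norm (A x i i) + 1"
      by (intro order_tendstoD) (auto simp: isCont_def)
    moreover have "\<forall>\<^sub>F t in at x. t \<in> J"
      using J(1) x by (intro eventually_at_in_open') 
    ultimately have "\<forall>\<^sub>F t in at x. norm (A t i d) \<le> sqrt (norm (A x i i) + 1) * norm (s t)"
    proof eventually_elim
      case (elim t)
      have "norm (A t d d) = (norm (s t))\<^sup>2"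
        using s(3)[OF elim(2)] by (metis norm_mult power2_eq_square)
      hence "Re (A t d d) \<le> (norm (s t))\<^sup>2" using complex_Re_le_cmod[of "A t d d"] by simp
      moreover have "Re (A t i i) \<le> norm (A x i i) + 1"
        using complex_Re_le_cmod[of "A t i i"] elim by simp
      moreover have "0 \<le> Re (A t d d)"
        using psd_form_diag[OF psd[OF elim(2)], of d] by (simp add: complex_nonneg_Reals_iff)
      ultimately have "Re (A t i i) * Re (A t d d) \<le> (norm (A x i i) + 1) * (norm (s t))\<^sup>2"
        by (intro mult_mono) auto
      also have "\<dots> = (sqrt (norm (A x i i) + 1) * norm (s t))\<^sup>2"
        by (simp add: power_mult_distrib)
      finally have "Re (A t i i) * Re (A t d d) \<le> (sqrt (norm (A x i i) + 1) * norm (s t))\<^sup>2" .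
      moreover have "(norm (A t i d))\<^sup>2 \<le> Re (A t i i) * Re (A t d d)"
        using i by (intro psd_form_cauchy_schwarz[OF psd[OF elim(2)]]) auto
      ultimately have "(norm (A t i d))\<^sup>2 \<le> (sqrt (norm (A x i i) + 1) * norm (s t))\<^sup>2"
        by (rule order_trans[rotated])
      thus ?case by (rule power2_le_imp_le) simp
    qed
    thus "\<exists>K. \<forall>\<^sub>F t in at x. norm (A t i d) \<le> K * norm (s t)" ..
  qed (use an i in auto)
  then obtain q where q: "\<And>i x. i < d \<Longrightarrow> x \<in> J \<Longrightarrow> real_analytic_at (q i) x"
    "\<And>i t. i < d \<Longrightarrow> t \<in> J \<Longrightarrow> A t i d = s t * q i t" by metis
  define l where "l = (\<lambda>t i. if i < d then q i t else s t)"
  have l_an: "real_analytic_at (\<lambda>t. l t i) x" if "x \<in> J" for x i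
    using q(1) s(1) that by (cases "i < d") (simp_all add: l_def)
  have l_col: "A t i d = l t i * cnj (l t d)" if "t \<in> J" "i < Suc d" for t i
    using that q(2)[of i t] s(3)[of t] cs[of t] by (cases "i < d") (auto simp: l_def less_Suc_eq)
  have off: "psd_form d (\<lambda>i j. A t i j - l t i * cnj (l t j))" if t: "t \<in> J" "A t d d \<noteq> 0" for t
  proof -
    have "A t i d * A t d j / A t d d = l t i * cnj (l t j)" if ij: "i < d" "j < d" for i j
    proof -
      have "A t d j = cnj (A t j d)" using psd_form_hermitian[OF psd[OF t(1)], of j d] ij by simp
      hence "A t i d * A t d j / A t d d = (s t * q i t) * (s t * cnj (q j t)) / (s t * s t)"
        using ij t q(2) s(3) cs by simp
      also have "\<dots> = q i t * cnj (q j t)" using t s(3)[OF t(1)] by (auto simp: field_simps)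
      finally show ?thesis using ij by (simp add: l_def)
    qed
    hence "(\<Sum>i<d. \<Sum>j<d. cnj (v i) * (A t i j - l t i * cnj (l t j)) * v j) =
      (\<Sum>i<d. \<Sum>j<d. cnj (v i) * (A t i j - A t i d * A t d j / A t d d) * v j)" for v
      by (intro sum.cong refl) simp
    thus ?thesis using psd_form_schur_complement[OF psd[OF t(1)] t(2)]
      unfolding psd_form_def by (simp only: simp_thms)
  qed
  \<comment> \<open>The Schur quotient is undefined at the zeros of the pivot, but \<open>l\<close>
    is analytic there, so each value of the form is a limit of nonnegative values.\<close>
  have "psd_form d (\<lambda>i j. A t i j - l t i * cnj (l t j))" if t: "t \<in> J" for t
    unfolding psd_form_def
  proof
    fix v :: "nat \<Rightarrow> complex"
    let ?h = "\<lambda>t. \<Sum>i<d. \<Sum>j<d. cnj (v i) * (A t i j - l t i * cnj (l t j)) * v j"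
    have "real_analytic_at ?h t"
      using an l_an t
      by (intro real_analytic_at_sum real_analytic_at_mult real_analytic_at_diff real_analytic_at_cnj
          real_analytic_at_const) auto
    hence "(?h \<longlongrightarrow> ?h t) (at t)"
      using real_analytic_at_imp_isCont by (simp add: isCont_def)
    moreover have "\<forall>\<^sub>F u in at t. A u d d \<noteq> 0"
      using real_analytic_identity[where f = "\<lambda>t. A t d d", OF J _ t0 t] an by simp
    hence "\<forall>\<^sub>F u in at t. ?h u \<in> \<real>\<^sub>\<ge>\<^sub>0"
      using eventually_at_in_open'[OF J(1) t]
    proof eventually_elim
      case (elim u)
      show ?case using off[OF elim(2,1)] unfolding psd_form_def by (rule spec)
    qed
    ultimately show "?h t \<in> \<real>\<^sub>\<ge>\<^sub>0" by (rule nonneg_Reals_tendsto) simp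
  qed
  with l_an l_col show ?thesis by blast
qed

lemma analytic_cholesky:
  assumes J: "open J" "connected J"
    and "\<And>x i j. x \<in> J \<Longrightarrow> i < d \<Longrightarrow> j < d \<Longrightarrow> real_analytic_at (\<lambda>t. A t i j) x"
    and "\<And>t. t \<in> J \<Longrightarrow> psd_form d (A t)"
  shows "\<exists>L. (\<forall>x\<in>J. \<forall>i<d. \<forall>k<d. real_analytic_at (\<lambda>t. L t i k) x) \<and>
    (\<forall>t\<in>J. \<forall>i<d. \<forall>j<d. A t i j = (\<Sum>k<d. L t i k * cnj (L t j k)))"
  using assms(3-)
proof (induction d arbitrary: A)
  case 0
  thus ?case by simp
next
  case (Suc d)
  from analytic_pivot_column[OF J Suc.prems] obtain l where
    l: "\<And>x i. x \<in> J \<Longrightarrow> i < Suc d \<Longrightarrow> real_analytic_at (\<lambda>t. l t i) x"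
      "\<And>t i. t \<in> J \<Longrightarrow> i < Suc d \<Longrightarrow> A t i d = l t i * cnj (l t d)"
      "\<And>t. t \<in> J \<Longrightarrow> psd_form d (\<lambda>i j. A t i j - l t i * cnj (l t j))" by blast
  have "\<exists>L. (\<forall>x\<in>J. \<forall>i<d. \<forall>k<d. real_analytic_at (\<lambda>t. L t i k) x) \<and>
    (\<forall>t\<in>J. \<forall>i<d. \<forall>j<d. A t i j - l t i * cnj (l t j) = (\<Sum>k<d. L t i k * cnj (L t j k)))"
    using l Suc.prems(1)
    by (intro Suc.IH[of "\<lambda>t i j. A t i j - l t i * cnj (l t j)"] real_analytic_at_diff real_analytic_at_mult real_analytic_at_cnj) auto
  then obtain L where L: "\<And>x i k. x \<in> J \<Longrightarrow> i < d \<Longrightarrow> k < d \<Longrightarrow> real_analytic_at (\<lambda>t. L t i k) x"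
    "\<And>t i j. t \<in> J \<Longrightarrow> i < d \<Longrightarrow> j < d \<Longrightarrow> A t i j - l t i * cnj (l t j) = (\<Sum>k<d. L t i k * cnj (L t j k))"
    by blast
  \<comment> \<open>Elimination starts at the last index, so the factor is upper triangular: the
    earlier columns get 0 in row \<open>d\<close>.\<close>
  define M where "M = (\<lambda>t i k. if k = d then l t i else if i = d then 0 else L t i k)"
  have "real_analytic_at (\<lambda>t. M t i k) x" if "x \<in> J" "i < Suc d" "k < Suc d" for x i k
    using that l(1) L(1) by (cases "k = d"; cases "i = d") (simp_all add: M_def less_Suc_eq)
  moreover have "A t i j = (\<Sum>k<Suc d. M t i k * cnj (M t j k))" if that: "t \<in> J" "i < Suc d" "j < Suc d" for t i j
  proof -
    have "i < d \<and> j < d \<or> j = d \<or> i = d \<and> j < d" using that(2,3) by linarith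
    then consider "i < d" "j < d" | "j = d" | "i = d" "j < d" by blast
    thus ?thesis
    proof cases
      case 1
      thus ?thesis using L(2)[OF that(1) 1] by (simp add: M_def algebra_simps)
    next
      case 2
      thus ?thesis using l(2)[OF that(1,2)] by (simp add: M_def)
    next
      case 3
      have "A t d j = cnj (A t j d)"
        using psd_form_hermitian[OF Suc.prems(2)[OF that(1)], of j d] that by simp
      thus ?thesis using 3 l(2)[OF that(1,3)] by (simp add: M_def)
    qed
  qed
  ultimately show ?case by (intro exI[of _ M]) blast
qed

section \<open>Analytic completion to a unitary matrix\<close>

text \<open>Bilinear rather than sesquilinear, so that it covers orthonormal columns and, with the
  indices exchanged, orthonormal rows.\<close>

lemma sum_orthonormal_contract:
  fixes M M' :: "nat \<Rightarrow> nat \<Rightarrow> complex"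
  assumes "\<And>r r'. r < N \<Longrightarrow> r' < N \<Longrightarrow> (\<Sum>p<N. M p r * M' p r') = (if r = r' then 1 else 0)"
  shows "(\<Sum>p<N. (\<Sum>r<N. M p r * x r) * (\<Sum>r<N. M' p r * y r)) = (\<Sum>r<N. x r * y r)"
proof -
  have "(\<Sum>p<N. (\<Sum>r<N. M p r * x r) * (\<Sum>r<N. M' p r * y r)) =
      (\<Sum>p<N. \<Sum>r<N. \<Sum>r'<N. x r * y r' * (M p r * M' p r'))"
    unfolding sum_product by (intro sum.cong refl) (simp add: mult_ac)
  also have "\<dots> = (\<Sum>r<N. \<Sum>p<N. \<Sum>r'<N. x r * y r' * (M p r * M' p r'))"
    by (rule sum.swap)
  also have "\<dots> = (\<Sum>r<N. \<Sum>r'<N. \<Sum>p<N. x r * y r' * (M p r * M' p r'))"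
    by (intro sum.cong refl sum.swap)
  also have "\<dots> = (\<Sum>r<N. \<Sum>r'<N. x r * y r' * (if r = r' then 1 else 0))"
    by (intro sum.cong refl) (simp add: assms flip: sum_distrib_left)
  also have "\<dots> = (\<Sum>r<N. x r * y r)"
    by (intro sum.cong refl) (simp add: mult_delta_right)
  finally show ?thesis .
qed

lemma orthonormal_columns_imp_rows:
  fixes U :: "nat \<Rightarrow> nat \<Rightarrow> complex"
  assumes "\<And>q q'. q < N \<Longrightarrow> q' < N \<Longrightarrow> (\<Sum>p<N. cnj (U p q) * U p q') = (if q = q' then 1 else 0)"
    and "p < N" "p' < N"
  shows "(\<Sum>q<N. U p q * cnj (U p' q)) = (if p = p' then 1 else 0)"
proof -
  define A where "A = mat N N (\<lambda>(q, p). cnj (U p q))"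
  define B where "B = mat N N (\<lambda>(p, q). U p q)"
  have AB: "A \<in> carrier_mat N N" "B \<in> carrier_mat N N" by (auto simp: A_def B_def)
  have "A * B = 1\<^sub>m N"
    using assms(1) by (intro eq_matI) (auto simp: A_def B_def scalar_prod_def atLeast0LessThan)
  hence "B * A = 1\<^sub>m N" by (rule mat_mult_left_right_inverse[OF AB])
  hence "(B * A) $$ (p, p') = (if p = p' then 1 else 0)" using assms by simp
  thus ?thesis using assms(2,3) by (simp add: A_def B_def scalar_prod_def atLeast0LessThan)
qed

text \<open>Here \<open>s\<close> is a signed length of \<open>b\<close> and \<open>c\<close> its
  direction, continued through the isolated zeros of \<open>b\<close>; for identically vanishing
  \<open>b\<close> the direction is taken to be 0. Entries of \<open>b\<close> that vanish
  identically stay zero in \<open>c\<close>, which later keeps finished columns intact.\<close>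

lemma real_analytic_unit_direction:
  fixes b :: "real \<Rightarrow> nat \<Rightarrow> complex"
  assumes J: "open J" "connected J"
    and an: "\<And>x i. x \<in> J \<Longrightarrow> i < N \<Longrightarrow> real_analytic_at (\<lambda>t. b t i) x"
  shows "\<exists>s c. (\<forall>x\<in>J. real_analytic_at s x) \<and> (\<forall>t\<in>J. cnj (s t) = s t) \<and>
    (\<forall>x\<in>J. \<forall>i<N. real_analytic_at (\<lambda>t. c t i) x) \<and>
    (\<forall>t\<in>J. \<forall>i<N. b t i = s t * c t i) \<and> (\<forall>t\<in>J. s t * s t = (\<Sum>i<N. cnj (b t i) * b t i)) \<and>
    (\<forall>i<N. (\<forall>t\<in>J. b t i = 0) \<longrightarrow> (\<forall>t\<in>J. c t i = 0)) \<and>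
    (\<forall>t\<in>J. (\<Sum>i<N. cnj (c t i) * c t i) = 1 \<or> (\<forall>i<N. c t i = 0))"
proof (cases "\<forall>t\<in>J. \<forall>i<N. b t i = 0")
  case True
  thus ?thesis by (intro exI[of _ "\<lambda>_. 0"] exI[of _ "\<lambda>_ _. 0"]) auto
next
  case False
  then obtain t0 i0 where t0: "t0 \<in> J" "i0 < N" "b t0 i0 \<noteq> 0" by blast
  define f where "f = (\<lambda>t. \<Sum>i<N. cnj (b t i) * b t i)"
  have f_real: "f t = complex_of_real (\<Sum>i<N. (cmod (b t i))\<^sup>2)" for t
    unfolding f_def of_real_sum by (intro sum.cong refl) (simp only: complex_norm_square mult.commute)
  have f_an: "real_analytic_at f x" if "x \<in> J" for x
    unfolding f_def using that an
    by (intro real_analytic_at_sum real_analytic_at_mult real_analytic_at_cnj) auto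
  have f_nn: "f t \<in> \<real>\<^sub>\<ge>\<^sub>0" for t
    unfolding f_real nonneg_Reals_of_real_iff by (intro sum_nonneg) simp
  obtain s where s: "\<And>x. x \<in> J \<Longrightarrow> real_analytic_at s x" "\<And>t. t \<in> J \<Longrightarrow> s t \<in> \<real>"
      "\<And>t. t \<in> J \<Longrightarrow> s t * s t = f t"
    using real_analytic_sqrt[OF J f_an f_nn] by blast
  have cs: "cnj (s t) = s t" if "t \<in> J" for t using s(2)[OF that] by (simp add: Reals_cnj_iff)
  have bs: "cmod (b t i) \<le> cmod (s t)" if "t \<in> J" "i < N" for t i
  proof -
    have "(cmod (s t))\<^sup>2 = cmod (f t)" using s(3)[OF that(1)] by (metis norm_mult power2_eq_square)
    also have "\<dots> = (\<Sum>i<N. (cmod (b t i))\<^sup>2)" unfolding f_real norm_of_real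
      by (intro abs_of_nonneg sum_nonneg) simp
    finally have "(cmod (b t i))\<^sup>2 \<le> (cmod (s t))\<^sup>2"
      using that(2) by (simp add: member_le_sum[of i "{..<N}" "\<lambda>i. (cmod (b t i))\<^sup>2"])
    thus ?thesis by (rule power2_le_imp_le) simp
  qed
  have s0: "s t0 \<noteq> 0" using bs[OF t0(1,2)] t0(3) by auto
  have "\<exists>q. (\<forall>x\<in>J. real_analytic_at q x) \<and> (\<forall>t\<in>J. b t i = s t * q t) \<and>
          ((\<forall>t\<in>J. b t i = 0) \<longrightarrow> (\<forall>t\<in>J. q t = 0))" if i: "i < N" for i
  proof (cases "\<forall>t\<in>J. b t i = 0")
    case True
    thus ?thesis by (intro exI[of _ "\<lambda>_. 0"]) auto
  next
    case False
    have "\<exists>q. (\<forall>x\<in>J. real_analytic_at q x) \<and> (\<forall>t\<in>J. b t i = s t * q t)"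
    proof (rule real_analytic_division[OF J _ s(1) t0(1) s0])
      fix x assume x: "x \<in> J"
      have "\<forall>\<^sub>F t in at x. t \<in> J" using J(1) x by (rule eventually_at_in_open')
      hence "\<forall>\<^sub>F t in at x. norm (b t i) \<le> 1 * norm (s t)"
        by eventually_elim (use bs i in auto)
      thus "\<exists>K. \<forall>\<^sub>F t in at x. norm (b t i) \<le> K * norm (s t)" ..
    qed (use an i in auto)
    thus ?thesis using False by blast
  qed
  then obtain q where q: "\<And>i x. i < N \<Longrightarrow> x \<in> J \<Longrightarrow> real_analytic_at (q i) x"
    "\<And>i t. i < N \<Longrightarrow> t \<in> J \<Longrightarrow> b t i = s t * q i t"
    "\<And>i t. i < N \<Longrightarrow> \<forall>t\<in>J. b t i = 0 \<Longrightarrow> t \<in> J \<Longrightarrow> q i t = 0" by metis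
  have "(\<Sum>i<N. cnj (q i t) * q i t) = 1" if t: "t \<in> J" for t
  proof (rule isCont_eqI)
    have "real_analytic_at (\<lambda>t. \<Sum>i<N. cnj (q i t) * q i t) t"
      using q t by (intro real_analytic_at_sum real_analytic_at_mult real_analytic_at_cnj) auto
    thus "isCont (\<lambda>t. \<Sum>i<N. cnj (q i t) * q i t) t" by (rule real_analytic_at_imp_isCont)
    show "isCont (\<lambda>_. 1) t" by simp
    have "\<forall>\<^sub>F u in at t. s u \<noteq> 0"
      by (rule real_analytic_identity[where f = s, OF J _ t0(1) s0 t]) (rule s(1))
    thus "\<forall>\<^sub>F t in at t. (\<Sum>i<N. cnj (q i t) * q i t) = 1"
      using eventually_at_in_open'[OF J(1) t]
    proof eventually_elim
      case (elim u)
      have "s u * s u * (\<Sum>i<N. cnj (q i u) * q i u) = (\<Sum>i<N. cnj (s u * q i u) * (s u * q i u))"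
        using elim cs by (simp add: sum_distrib_left mult_ac)
      also have "\<dots> = s u * s u"
        unfolding s(3)[OF elim(2)] f_def using q(2) elim by simp
      finally show ?case using elim(1) by simp
    qed
  qed
  with s(1) cs q s(3) show ?thesis
    by (intro exI[of _ s] exI[of _ "\<lambda>t i. q i t"]) (simp add: f_def)
qed

text \<open>With \<open>w = (a, b)\<close>, where \<open>a\<close> is the entry at \<open>k0\<close> and \<open>b = s c\<close> with \<open>c\<close> of norm one, the matrix is
  \<open>(a, - s c\<^sup>*; s c, 1 - (1 - cnj a) c c\<^sup>*)\<close>.\<close>
lemma analytic_unitary_with_column:
  fixes w :: "real \<Rightarrow> nat \<Rightarrow> complex"
  assumes J: "open J" "connected J" and k0: "k0 < N"
    and an: "\<And>x i. x \<in> J \<Longrightarrow> i < N \<Longrightarrow> real_analytic_at (\<lambda>t. w t i) x"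
    and unit: "\<And>t. t \<in> J \<Longrightarrow> (\<Sum>i<N. cnj (w t i) * w t i) = 1"
  shows "\<exists>G. (\<forall>x\<in>J. \<forall>p<N. \<forall>q<N. real_analytic_at (\<lambda>t. G t p q) x) \<and>
    (\<forall>t\<in>J. \<forall>q<N. \<forall>q'<N. (\<Sum>p<N. cnj (G t p q) * G t p q') = (if q = q' then 1 else 0)) \<and>
    (\<forall>t\<in>J. \<forall>p<N. G t p k0 = w t p) \<and>
    (\<forall>q<N. q \<noteq> k0 \<longrightarrow> (\<forall>t\<in>J. w t q = 0) \<longrightarrow> (\<forall>t\<in>J. \<forall>p<N. G t p q = (if p = q then 1 else 0)))"
proof -
  define b where "b = (\<lambda>t i. if i = k0 then 0 else w t i)"
  have b_an: "real_analytic_at (\<lambda>t. b t i) x" if "x \<in> J" "i < N" for x i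
    using an that by (cases "i = k0") (simp_all add: b_def)
  have "\<exists>s c. (\<forall>x\<in>J. real_analytic_at s x) \<and> (\<forall>t\<in>J. cnj (s t) = s t) \<and>
    (\<forall>x\<in>J. \<forall>i<N. real_analytic_at (\<lambda>t. c t i) x) \<and>
    (\<forall>t\<in>J. \<forall>i<N. b t i = s t * c t i) \<and> (\<forall>t\<in>J. s t * s t = (\<Sum>i<N. cnj (b t i) * b t i)) \<and>
    (\<forall>i<N. (\<forall>t\<in>J. b t i = 0) \<longrightarrow> (\<forall>t\<in>J. c t i = 0)) \<and>
    (\<forall>t\<in>J. (\<Sum>i<N. cnj (c t i) * c t i) = 1 \<or> (\<forall>i<N. c t i = 0))" (is "\<exists>s c. ?P s c")
    by (rule real_analytic_unit_direction[OF J b_an])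
  then obtain s c where sc: "?P s c" by (elim exE) (rule that)
  have
    s: "\<And>x. x \<in> J \<Longrightarrow> real_analytic_at s x" "\<And>t. t \<in> J \<Longrightarrow> cnj (s t) = s t" and
    c: "\<And>x i. x \<in> J \<Longrightarrow> i < N \<Longrightarrow> real_analytic_at (\<lambda>t. c t i) x"
    and bc: "\<And>t i. t \<in> J \<Longrightarrow> i < N \<Longrightarrow> b t i = s t * c t i"
    and ss: "\<And>t. t \<in> J \<Longrightarrow> s t * s t = (\<Sum>i<N. cnj (b t i) * b t i)"
    and c0: "\<And>i t. i < N \<Longrightarrow> \<forall>t\<in>J. b t i = 0 \<Longrightarrow> t \<in> J \<Longrightarrow> c t i = 0"
    and c1: "\<And>t. t \<in> J \<Longrightarrow> (\<Sum>i<N. cnj (c t i) * c t i) = 1 \<or> (\<forall>i<N. c t i = 0)"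
    using sc by blast+
  have ck0: "c t k0 = 0" if "t \<in> J" for t
    using c0[OF k0 _ that] by (simp add: b_def)
  \<comment> \<open>Where \<open>c\<close> has norm one, \<open>G\<close> acts on the span of the
    basis vector at \<open>k0\<close> and \<open>c\<close> as the unitary with rows
    \<open>(a, - s)\<close> and \<open>(s, cnj a)\<close>, and as the identity on the orthogonal
    complement. The coefficient \<open>1 - cnj a\<close> is what turns eigenvalue 1 into
    \<open>cnj a\<close> along \<open>c\<close>.\<close>
  define G where "G = (\<lambda>t p q. if q = k0 then w t p else if p = k0 then - (s t * cnj (c t q))
     else (if p = q then 1 else 0) - (1 - cnj (w t k0)) * (c t p * cnj (c t q)))"
  have "real_analytic_at (\<lambda>t. G t p q) x" if "x \<in> J" "p < N" "q < N" for x p q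
  proof -
    have "real_analytic_at (\<lambda>t. - (s t * cnj (c t q))) x"
      by (intro real_analytic_at_uminus real_analytic_at_mult real_analytic_at_cnj s(1) c that)
    moreover have "real_analytic_at (\<lambda>t. (if p = q then 1 else 0) - (1 - cnj (w t k0)) * (c t p * cnj (c t q))) x"
      by (intro real_analytic_at_diff real_analytic_at_mult real_analytic_at_cnj real_analytic_at_const an c that k0)
    ultimately show ?thesis
      using an[OF that(1,2)] by (cases "q = k0"; cases "p = k0") (simp_all add: G_def)
  qed
  moreover have "(\<Sum>p<N. cnj (G t p q) * G t p q') = (if q = q' then 1 else 0)"
    if t: "t \<in> J" and q: "q < N" "q' < N" for t q q'
  proof -
    define a where "a = w t k0"
    define \<gamma> where "\<gamma> = (\<Sum>p<N. cnj (c t p) * c t p)"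
    have \<gamma>: "\<gamma> = 1 \<or> (\<forall>i<N. c t i = 0)" using c1[OF t] by (simp add: \<gamma>_def)
    have split: "(\<Sum>p<N. h p) = h k0 + (\<Sum>p\<in>{..<N} - {k0}. h p)" for h :: "nat \<Rightarrow> complex"
      using k0 by (simp add: sum.remove)
    have w: "w t p = s t * c t p" if "p < N" "p \<noteq> k0" for p
      using bc[OF t that(1)] that(2) by (simp add: b_def)
    have G1: "G t p k0 = s t * c t p" if "p \<in> {..<N} - {k0}" for p
      using that w by (simp add: G_def)
    have G2: "G t p r = (if p = r then 1 else 0) - (1 - cnj a) * (c t p * cnj (c t r))"
      if "p \<in> {..<N} - {k0}" "r \<noteq> k0" for p r
      using that by (simp add: G_def a_def)
    have s\<gamma>: "cnj a * a + s t * s t = 1"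
    proof -
      have "s t * s t = (\<Sum>p\<in>{..<N} - {k0}. cnj (w t p) * w t p)"
        unfolding ss[OF t] split[of "\<lambda>i. cnj (b t i) * b t i"] by (simp add: b_def)
      thus ?thesis using unit[OF t] split[of "\<lambda>i. cnj (w t i) * w t i"] by (simp add: a_def)
    qed
    have \<gamma>': "(\<Sum>p\<in>{..<N} - {k0}. cnj (c t p) * c t p) = \<gamma>"
      unfolding \<gamma>_def split[of "\<lambda>i. cnj (c t i) * c t i"] using ck0[OF t] by simp
    have pick: "(\<Sum>p\<in>{..<N} - {k0}. h p * (if p = r then 1 else 0)) = h r"
      if "r < N" "r \<noteq> k0" for r and h :: "nat \<Rightarrow> complex"
      using that by (simp add: mult_delta_right)
    have off: "(\<Sum>p<N. cnj (w t p) * G t p r) = 0" if r: "r < N" "r \<noteq> k0" for r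
    proof -
      have "(\<Sum>p\<in>{..<N} - {k0}. cnj (w t p) * G t p r) =
        (\<Sum>p\<in>{..<N} - {k0}. s t * cnj (c t p) * (if p = r then 1 else 0)
            - (s t * (1 - cnj a) * cnj (c t r)) * (cnj (c t p) * c t p))"
        using r s(2)[OF t] by (intro sum.cong refl) (simp add: w G2 right_diff_distrib mult_ac)
      also have "\<dots> = s t * cnj (c t r) - s t * (1 - cnj a) * cnj (c t r) * \<gamma>"
        unfolding sum_subtractf pick[OF r] sum_distrib_left[symmetric] \<gamma>' ..
      finally have "(\<Sum>p<N. cnj (w t p) * G t p r) =
          - (cnj a * s t * cnj (c t r)) + (s t * cnj (c t r) - s t * (1 - cnj a) * cnj (c t r) * \<gamma>)"
        unfolding split[of "\<lambda>p. cnj (w t p) * G t p r"] using r by (simp add: G_def a_def)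
      also have "\<dots> = 0" using \<gamma> r by (auto simp: algebra_simps)
      finally show ?thesis .
    qed
    show ?thesis
    proof (cases "q = k0")
      case True
      hence G: "G t p q = w t p" for p by (simp add: G_def)
      show ?thesis
      proof (cases "q' = k0")
        case True
        thus ?thesis using unit[OF t] \<open>q = k0\<close> by (simp add: G_def)
      next
        case False
        thus ?thesis unfolding G using off[OF q(2) False] True by simp
      qed
    next
      case q0: False
      show ?thesis
      proof (cases "q' = k0")
        case True
        have "(\<Sum>p<N. cnj (G t p q) * G t p q') = cnj (\<Sum>p<N. cnj (w t p) * G t p q)"
          using True by (simp add: G_def mult.commute)
        thus ?thesis using off[OF q(1) q0] q0 True by simp
      next
        case q'0: False
        have "(\<Sum>p\<in>{..<N} - {k0}. cnj (G t p q) * G t p q') =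
          (\<Sum>p\<in>{..<N} - {k0}. (if p = q then 1 else 0) * (if p = q' then 1 else 0)
            - ((1 - cnj a) * cnj (c t q') * c t p) * (if p = q then 1 else 0)
            - ((1 - a) * c t q * cnj (c t p)) * (if p = q' then 1 else 0)
            + ((1 - a) * (1 - cnj a) * (c t q * cnj (c t q'))) * (cnj (c t p) * c t p))"
          using q0 q'0 by (intro sum.cong refl) (simp add: G2 algebra_simps)
        also have "\<dots> = (if q = q' then 1 else 0) - (1 - cnj a) * cnj (c t q') * c t q
            - (1 - a) * c t q * cnj (c t q') + (1 - a) * (1 - cnj a) * (c t q * cnj (c t q')) * \<gamma>"
          unfolding sum.distrib sum_subtractf pick[OF q(1) q0] pick[OF q(2) q'0]
            sum_distrib_left[symmetric] \<gamma>' by (simp add: eq_commute)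
        finally have "(\<Sum>p<N. cnj (G t p q) * G t p q') = s t * s t * (c t q * cnj (c t q')) + 
            ((if q = q' then 1 else 0) - (1 - cnj a) * cnj (c t q') * c t q
            - (1 - a) * c t q * cnj (c t q') + (1 - a) * (1 - cnj a) * (c t q * cnj (c t q')) * \<gamma>)"
          unfolding split[of "\<lambda>p. cnj (G t p q) * G t p q'"] using q0 q'0 s(2)[OF t]
          by (simp add: G_def mult_ac)
        \<comment> \<open>The point is \<open>(1 - a) + (1 - cnj a) - (1 - a) * (1 - cnj a) = 1 -
          cnj a * a\<close>, which is \<open>s t * s t\<close>. If \<open>c\<close> vanishes at
          \<open>t\<close>, so does every correction term.\<close>
        also have "\<dots> = (if q = q' then 1 else 0)"
        proof (cases "\<gamma> = 1")
          case True
          have "s t * s t * (c t q * cnj (c t q')) + 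
            ((if q = q' then 1 else 0) - (1 - cnj a) * cnj (c t q') * c t q
            - (1 - a) * c t q * cnj (c t q') + (1 - a) * (1 - cnj a) * (c t q * cnj (c t q')) * \<gamma>)
            = (cnj a * a + s t * s t - 1) * (c t q * cnj (c t q')) + (if q = q' then 1 else 0)"
            unfolding True by (simp add: algebra_simps)
          thus ?thesis by (simp add: s\<gamma>)
        next
          case False
          thus ?thesis using \<gamma> q by simp
        qed
        finally show ?thesis .
      qed
    qed
  qed
  moreover have "G t p k0 = w t p" for t p by (simp add: G_def)
  \<comment> \<open>Columns at which \<open>w\<close> vanishes identically are left alone; this
    protects the columns completed before.\<close>
  moreover have "G t p q = (if p = q then 1 else 0)"
    if "q < N" "q \<noteq> k0" "\<forall>t\<in>J. w t q = 0" "t \<in> J" for t p q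
  proof -
    have "c t q = 0" using that by (intro c0) (auto simp: b_def)
    thus ?thesis using that by (simp add: G_def)
  qed
  ultimately show ?thesis by (intro exI[of _ G]) blast
qed

text \<open>A new column is read in the basis formed by the columns of the current \<open>U\<close>.
  Its coordinates \<open>w\<close> vanish on \<open>K\<close> by orthonormality, so multiplying
  \<open>U\<close> on the right by a unitary with column \<open>w\<close> at \<open>k0\<close> and
  standard columns on \<open>K\<close> inserts it and keeps the others. \<open>K\<close> is
  arbitrary because the isometry will occupy scattered columns.\<close>

lemma analytic_unitary_completion:
  fixes V :: "real \<Rightarrow> nat \<Rightarrow> nat \<Rightarrow> complex"
  assumes J: "open J" "connected J" and K: "finite K" "K \<subseteq> {..<N}"
    and "\<And>x p k. x \<in> J \<Longrightarrow> p < N \<Longrightarrow> k \<in> K \<Longrightarrow> real_analytic_at (\<lambda>t. V t p k) x"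
    and "\<And>t k k'. t \<in> J \<Longrightarrow> k \<in> K \<Longrightarrow> k' \<in> K \<Longrightarrow>
       (\<Sum>p<N. cnj (V t p k) * V t p k') = (if k = k' then 1 else 0)"
  shows "\<exists>U. (\<forall>x\<in>J. \<forall>p<N. \<forall>q<N. real_analytic_at (\<lambda>t. U t p q) x) \<and>
    (\<forall>t\<in>J. \<forall>q<N. \<forall>q'<N. (\<Sum>p<N. cnj (U t p q) * U t p q') = (if q = q' then 1 else 0)) \<and>
    (\<forall>t\<in>J. \<forall>p<N. \<forall>k\<in>K. U t p k = V t p k)"
  using K assms(5-)
proof (induction K rule: finite_induct)
  case empty
  show ?case
    by (intro exI[of _ "\<lambda>_ p q. if p = q then 1 else 0"]) (simp add: mult_delta_right)
next
  case (insert k0 K)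
  have k0: "k0 < N" and KN: "K \<subseteq> {..<N}" using insert.prems(1) by auto
  have "\<exists>U. (\<forall>x\<in>J. \<forall>p<N. \<forall>q<N. real_analytic_at (\<lambda>t. U t p q) x) \<and>
    (\<forall>t\<in>J. \<forall>q<N. \<forall>q'<N. (\<Sum>p<N. cnj (U t p q) * U t p q') = (if q = q' then 1 else 0)) \<and>
    (\<forall>t\<in>J. \<forall>p<N. \<forall>k\<in>K. U t p k = V t p k)" (is "\<exists>U. ?P U")
    using insert.prems by (intro insert.IH[OF KN]) auto
  then obtain U where U: "?P U" by (elim exE) (rule that)
  have
    U_an: "\<And>x p q. x \<in> J \<Longrightarrow> p < N \<Longrightarrow> q < N \<Longrightarrow> real_analytic_at (\<lambda>t. U t p q) x" and
    U_col: "\<And>t q q'. t \<in> J \<Longrightarrow> q < N \<Longrightarrow> q' < N \<Longrightarrow>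
       (\<Sum>p<N. cnj (U t p q) * U t p q') = (if q = q' then 1 else 0)" and
    UV: "\<And>t p k. t \<in> J \<Longrightarrow> p < N \<Longrightarrow> k \<in> K \<Longrightarrow> U t p k = V t p k"
    using U by blast+
  have U_row: "(\<Sum>q<N. U t p q * cnj (U t p' q)) = (if p = p' then 1 else 0)"
    if "t \<in> J" "p < N" "p' < N" for t p p'
    by (rule orthonormal_columns_imp_rows[OF U_col[OF that(1)] that(2,3)])
  define w where "w = (\<lambda>t r. \<Sum>p<N. cnj (U t p r) * V t p k0)"
  have w_an: "real_analytic_at (\<lambda>t. w t r) x" if "x \<in> J" "r < N" for x r
    unfolding w_def using that U_an insert.prems(2)
    by (intro real_analytic_at_sum real_analytic_at_mult real_analytic_at_cnj) auto
  have w_unit: "(\<Sum>r<N. cnj (w t r) * w t r) = 1" if t: "t \<in> J" for t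
  proof -
    have "(\<Sum>r<N. cnj (w t r) * w t r) =
      (\<Sum>r<N. (\<Sum>p<N. U t p r * cnj (V t p k0)) * (\<Sum>p<N. cnj (U t p r) * V t p k0))"
      by (simp add: w_def)
    also have "\<dots> = (\<Sum>p<N. cnj (V t p k0) * V t p k0)"
      by (rule sum_orthonormal_contract[where M = "\<lambda>r p. U t p r" and M' = "\<lambda>r p. cnj (U t p r)"])
        (rule U_row[OF t])
    also have "\<dots> = 1" using insert.prems(3)[OF t, of k0 k0] by simp
    finally show ?thesis .
  qed
  have w0: "w t k = 0" if "k \<in> K" "t \<in> J" for k t
  proof -
    have "w t k = (\<Sum>p<N. cnj (V t p k) * V t p k0)"
      unfolding w_def using UV that by simp
    also have "\<dots> = 0"
      using insert.prems(3)[OF that(2), of k k0] that(1) insert.hyps(2) by auto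
    finally show ?thesis .
  qed
  have "\<exists>G. (\<forall>x\<in>J. \<forall>p<N. \<forall>q<N. real_analytic_at (\<lambda>t. G t p q) x) \<and>
    (\<forall>t\<in>J. \<forall>q<N. \<forall>q'<N. (\<Sum>p<N. cnj (G t p q) * G t p q') = (if q = q' then 1 else 0)) \<and>
    (\<forall>t\<in>J. \<forall>p<N. G t p k0 = w t p) \<and>
    (\<forall>q<N. q \<noteq> k0 \<longrightarrow> (\<forall>t\<in>J. w t q = 0) \<longrightarrow> (\<forall>t\<in>J. \<forall>p<N. G t p q = (if p = q then 1 else 0)))"
    (is "\<exists>G. ?P G")
    by (rule analytic_unitary_with_column[OF J k0 w_an w_unit])
  then obtain G where G: "?P G" by (elim exE) (rule that)
  have
    G_an: "\<And>x p q. x \<in> J \<Longrightarrow> p < N \<Longrightarrow> q < N \<Longrightarrow> real_analytic_at (\<lambda>t. G t p q) x" and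
    G_col: "\<And>t q q'. t \<in> J \<Longrightarrow> q < N \<Longrightarrow> q' < N \<Longrightarrow>
       (\<Sum>p<N. cnj (G t p q) * G t p q') = (if q = q' then 1 else 0)" and
    G_w: "\<And>t p. t \<in> J \<Longrightarrow> p < N \<Longrightarrow> G t p k0 = w t p" and
    G_id: "\<And>q t p. q < N \<Longrightarrow> q \<noteq> k0 \<Longrightarrow> \<forall>t\<in>J. w t q = 0 \<Longrightarrow> t \<in> J \<Longrightarrow> p < N \<Longrightarrow>
       G t p q = (if p = q then 1 else 0)"
    using G by blast+
  define W where "W = (\<lambda>t p q. \<Sum>r<N. U t p r * G t r q)"
  have "real_analytic_at (\<lambda>t. W t p q) x" if "x \<in> J" "p < N" "q < N" for x p q
    unfolding W_def using that U_an G_an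
    by (intro real_analytic_at_sum real_analytic_at_mult) auto
  moreover have "(\<Sum>p<N. cnj (W t p q) * W t p q') = (if q = q' then 1 else 0)"
    if "t \<in> J" "q < N" "q' < N" for t q q'
  proof -
    have "(\<Sum>p<N. cnj (W t p q) * W t p q') =
      (\<Sum>p<N. (\<Sum>r<N. cnj (U t p r) * cnj (G t r q)) * (\<Sum>r<N. U t p r * G t r q'))"
      by (simp add: W_def)
    also have "\<dots> = (\<Sum>r<N. cnj (G t r q) * G t r q')"
      by (rule sum_orthonormal_contract) (rule U_col[OF that(1)])
    finally show ?thesis using G_col that by simp
  qed
  moreover have "W t p k = V t p k" if t: "t \<in> J" and p: "p < N" and k: "k \<in> insert k0 K" for t p k
  proof (cases "k = k0")
    case True
    have "W t p k = (\<Sum>r<N. \<Sum>p'<N. U t p r * (cnj (U t p' r) * V t p' k0))"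
      unfolding W_def True using t by (simp add: G_w w_def sum_distrib_left)
    also have "\<dots> = (\<Sum>p'<N. \<Sum>r<N. U t p r * (cnj (U t p' r) * V t p' k0))"
      by (rule sum.swap)
    also have "\<dots> = (\<Sum>p'<N. (if p = p' then 1 else 0) * V t p' k0)"
      using U_row[OF t p] by (simp flip: sum_distrib_right mult.assoc)
    also have "\<dots> = V t p k" using p True by (simp add: mult_delta_left)
    finally show ?thesis .
  next
    case False
    hence "k \<in> K" "k < N" using k KN by auto
    hence "W t p k = (\<Sum>r<N. U t p r * (if r = k then 1 else 0))"
      unfolding W_def using G_id[of k t] False w0 t by simp
    also have "\<dots> = V t p k" using \<open>k < N\<close> \<open>k \<in> K\<close> UV t p by (simp add: mult_delta_right)
    finally show ?thesis .
  qed
  ultimately show ?case by (intro exI[of _ W]) blast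
qed

section \<open>Choi matrix and dilation\<close>

lemma sum_lessThan_mult:
  fixes f :: "nat \<Rightarrow> 'a::comm_monoid_add"
  shows "(\<Sum>p<n * m. f p) = (\<Sum>k<n. \<Sum>a<m. f (k * m + a))"
proof (induction n)
  case (Suc n)
  have "(\<Sum>p<Suc n * m. f p) = (\<Sum>p<n * m. f p) + (\<Sum>p = n * m..<n * m + m. f p)"
    by (simp add: add.commute sum.atLeastLessThan_concat flip: atLeast0LessThan)
  also have "(\<Sum>p = n * m..<n * m + m. f p) = (\<Sum>a<m. f (n * m + a))"
    using sum.shift_bounds_nat_ivl[of f 0 "n * m" m] by (simp add: atLeast0LessThan add.commute)
  finally show ?case using Suc by simp
qed simp

lemma pair_index_less:
  fixes k n m a :: nat
  assumes "k < n" "a < m"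
  shows "k * m + a < n * m"
proof -
  have "k * m + a < Suc k * m" using assms by simp
  also have "\<dots> \<le> n * m" using assms by (intro mult_le_mono1) simp
  finally show ?thesis .
qed

lemma psd_imp_psd_form:
  assumes "psd d A"
  shows "psd_form d (\<lambda>i j. A $$ (i, j))"
  unfolding psd_form_def
proof
  fix v :: "nat \<Rightarrow> complex"
  let ?q = "\<Sum>i<d. \<Sum>j<d. cnj (vec_index (vec d v) i) * A $$ (i, j) * vec_index (vec d v) j"
  have "Im ?q = 0 \<and> Re ?q \<ge> 0"
    using assms vec_carrier[of d v] unfolding psd_def Let_def by (elim conjE bspec)
  moreover have "?q = (\<Sum>i<d. \<Sum>j<d. cnj (v i) * A $$ (i, j) * v j)"
    by (intro sum.cong refl) simp
  ultimately show "(\<Sum>i<d. \<Sum>j<d. cnj (v i) * A $$ (i, j) * v j) \<in> \<real>\<^sub>\<ge>\<^sub>0"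
    by (simp add: complex_nonneg_Reals_iff)
qed

text \<open>The index \<open>k * n + i\<close> pairs the input index \<open>k\<close> with the
  output index \<open>i\<close>, in the block order of \<open>ampliation\<close>.\<close>

definition choi :: "nat \<Rightarrow> (complex mat \<Rightarrow> complex mat) \<Rightarrow> nat \<Rightarrow> nat \<Rightarrow> complex" where
  "choi n \<Phi> p q = \<Phi> (mat_unit n (p div n) (q div n)) $$ (p mod n, q mod n)"

lemma choi_pair:
  assumes "i < n" "j < n"
  shows "choi n \<Phi> (k * n + i) (l * n + j) = \<Phi> (mat_unit n k l) $$ (i, j)"
  using assms by (simp add: choi_def)

lemma psd_form_choi:
  assumes "CPTP n \<Phi>"
  shows "psd_form (n * n) (choi n \<Phi>)"
proof -
  \<comment> \<open>The unnormalized maximally entangled vector: the blocks of its projector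
    \<open>X\<close> are the matrix units, so the ampliation of \<open>X\<close> is the Choi
    matrix.\<close>
  define e :: "nat \<Rightarrow> complex" where "e = (\<lambda>p. if p div n = p mod n then 1 else 0)"
  define X where "X = mat (n * n) (n * n) (\<lambda>(p, q). e p * e q)"
  have "psd (n * n) X"
    unfolding psd_def Let_def
  proof (intro conjI ballI)
    fix v :: "complex vec" assume "v \<in> carrier_vec (n * n)"
    define S where "S = (\<Sum>j<n * n. e j * vec_index v j)"
    have ce: "cnj (e i) = e i" for i by (simp add: e_def)
    have "(\<Sum>i<n * n. \<Sum>j<n * n. cnj (vec_index v i) * X $$ (i, j) * vec_index v j) = cnj S * S"
      unfolding S_def cnj_sum sum_product by (intro sum.cong refl) (simp add: X_def ce mult_ac)
    also have "\<dots> = complex_of_real ((cmod S)\<^sup>2)" by (simp only: complex_norm_square mult.commute)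
    finally have *: "(\<Sum>i<n * n. \<Sum>j<n * n. cnj (vec_index v i) * X $$ (i, j) * vec_index v j) =
        complex_of_real ((cmod S)\<^sup>2)" .
    show "Im (\<Sum>i<n * n. \<Sum>j<n * n. cnj (vec_index v i) * X $$ (i, j) * vec_index v j) = 0"
      "0 \<le> Re (\<Sum>i<n * n. \<Sum>j<n * n. cnj (vec_index v i) * X $$ (i, j) * vec_index v j)"
      unfolding * by (simp_all only: Im_complex_of_real Re_complex_of_real zero_le_power2)
  qed (simp add: X_def)
  hence "psd (n * n) (ampliation n n \<Phi> X)" using assms by (simp add: CPTP_def)
  hence "psd_form (n * n) (\<lambda>p q. ampliation n n \<Phi> X $$ (p, q))" by (rule psd_imp_psd_form)
  moreover have "ampliation n n \<Phi> X $$ (p, q) = choi n \<Phi> p q" if pq: "p < n * n" "q < n * n" for p q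
  proof -
    have div: "p div n < n" "q div n < n" using pq by (auto intro: less_mult_imp_div_less)
    have "mat n n (\<lambda>(a, b). X $$ ((p div n) * n + a, (q div n) * n + b)) = mat_unit n (p div n) (q div n)"
      by (intro eq_matI) (use pair_index_less[OF div(1)] pair_index_less[OF div(2)] in
        \<open>auto simp: X_def e_def mat_unit_def\<close>)
    thus ?thesis using pq by (simp add: ampliation_def choi_def)
  qed
  ultimately show ?thesis unfolding psd_form_def by simp
qed

section \<open>Channels in terms of matrix units\<close>

lemma CPTP_matrix_units:
  assumes \<Phi>: "CPTP n \<Phi>" and \<rho>: "\<rho> \<in> carrier_mat n n" and ij: "i < n" "j < n"
  shows "\<Phi> \<rho> $$ (i, j) = (\<Sum>k<n. \<Sum>l<n. \<rho> $$ (k, l) * \<Phi> (mat_unit n k l) $$ (i, j))"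
proof -
  define M where "M = (\<lambda>S. mat n n (\<lambda>(k, l). if (k, l) \<in> S then \<rho> $$ (k, l) else 0))"
  have M: "M S \<in> carrier_mat n n" for S by (simp add: M_def)
  have E: "mat_unit n k l \<in> carrier_mat n n" for k l by (simp add: mat_unit_def)
  have carr: "\<Phi> A \<in> carrier_mat n n" if "A \<in> carrier_mat n n" for A
    using \<Phi> that by (simp add: CPTP_def)
  have lin: "\<Phi> (c \<cdot>\<^sub>m A + B) $$ (i, j) = c * \<Phi> A $$ (i, j) + \<Phi> B $$ (i, j)"
    if "A \<in> carrier_mat n n" "B \<in> carrier_mat n n" for A B c
  proof -
    have "\<Phi> (c \<cdot>\<^sub>m A + B) = c \<cdot>\<^sub>m \<Phi> A + \<Phi> B" using \<Phi> that by (simp add: CPTP_def)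
    thus ?thesis using carr[OF that(1)] carr[OF that(2)] ij by simp
  qed
  have *: "\<Phi> (M S) $$ (i, j) = (\<Sum>(k, l)\<in>S. \<rho> $$ (k, l) * \<Phi> (mat_unit n k l) $$ (i, j))"
    if "finite S" "S \<subseteq> {..<n} \<times> {..<n}" for S
    using that
  proof (induction S rule: finite_induct)
    case empty
    \<comment> \<open>Linearity is given only for sums \<open>c A + B\<close>; the choice
      \<open>c = -1\<close> extracts that the zero matrix is sent to zero.\<close>
    have "(-1) \<cdot>\<^sub>m M {} + M {} = M {}" by (intro eq_matI) (auto simp: M_def)
    thus ?case using lin[OF M M, of "-1" "{}" "{}"] by simp
  next
    case (insert x S)
    obtain k l where x: "x = (k, l)" by (cases x)
    have "M (insert x S) = \<rho> $$ (k, l) \<cdot>\<^sub>m mat_unit n k l + M S"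
      using insert.hyps(2) insert.prems by (intro eq_matI) (auto simp: M_def mat_unit_def x)
    hence "\<Phi> (M (insert x S)) $$ (i, j) = \<rho> $$ (k, l) * \<Phi> (mat_unit n k l) $$ (i, j) + \<Phi> (M S) $$ (i, j)"
      using lin[OF E M] by simp
    thus ?case using insert by (simp add: x)
  qed
  have "M ({..<n} \<times> {..<n}) = \<rho>" using \<rho> by (intro eq_matI) (auto simp: M_def)
  thus ?thesis using *[of "{..<n} \<times> {..<n}"] by (simp add: sum.cartesian_product)
qed

text \<open>Trace preservation in the form in which it is needed: it becomes the orthonormality of
  the prescribed columns of the dilation.\<close>

lemma CPTP_choi_trace:
  assumes \<Phi>: "CPTP n \<Phi>" and "k < n" "l < n"
  shows "(\<Sum>i<n. choi n \<Phi> (k * n + i) (l * n + i)) = (if k = l then 1 else 0)"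
proof -
  have E: "mat_unit n k l \<in> carrier_mat n n" by (simp add: mat_unit_def)
  have "\<Phi> (mat_unit n k l) \<in> carrier_mat n n" using \<Phi> E by (simp add: CPTP_def)
  hence "(\<Sum>i<n. choi n \<Phi> (k * n + i) (l * n + i)) = mtrace (\<Phi> (mat_unit n k l))"
    by (simp add: mtrace_def choi_pair)
  also have "\<dots> = mtrace (mat_unit n k l)" using \<Phi> E by (simp add: CPTP_def)
  also have "\<dots> = (\<Sum>i<n. if i = k then (if k = l then 1 else 0) else 0)"
    unfolding mtrace_def by (intro sum.cong) (auto simp: mat_unit_def)
  also have "\<dots> = (if k = l then 1 else 0)" using assms by simp
  finally show ?thesis .
qed

section \<open>Unitaries and partial traces in coordinates\<close>

lemma dagger_carrier: "A \<in> carrier_mat p q \<Longrightarrow> dagger A \<in> carrier_mat q p"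
  by (auto simp: dagger_def)

lemma unitary_mat_of_orthonormal_columns:
  assumes "\<And>q q'. q < N \<Longrightarrow> q' < N \<Longrightarrow> (\<Sum>p<N. cnj (W p q) * W p q') = (if q = q' then 1 else 0)"
  shows "unitary_mat N (mat N N (\<lambda>(p, q). W p q))"
proof -
  let ?U = "mat N N (\<lambda>(p, q). W p q)"
  have U: "?U \<in> carrier_mat N N" by simp
  have "dagger ?U * ?U = 1\<^sub>m N"
    using assms by (intro eq_matI) (auto simp: dagger_def scalar_prod_def atLeast0LessThan)
  moreover from this have "?U * dagger ?U = 1\<^sub>m N"
    by (rule mat_mult_left_right_inverse[OF dagger_carrier[OF U] U])
  ultimately show ?thesis using U by (simp add: unitary_mat_def)
qed

lemma index_mult_mat_sum:
  assumes "A \<in> carrier_mat a b" "B \<in> carrier_mat b c" "i < a" "j < c"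
  shows "(A * B) $$ (i, j) = (\<Sum>k<b. A $$ (i, k) * B $$ (k, j))"
  using assms by (simp add: scalar_prod_def atLeast0LessThan)

text \<open>The environment starts in its basis vector 0, so only the columns \<open>k * m\<close>
  of \<open>W\<close> enter. Their entries with environment index \<open>a\<close> form the Kraus
  operator number \<open>a\<close>.\<close>

lemma ptrace_dilation_index:
  assumes m: "m > 0" and W: "W \<in> carrier_mat (n * m) (n * m)" and \<rho>: "\<rho> \<in> carrier_mat n n" and ij: "i < n" "j < n"
  shows "ptrace_E n m (W * kron \<rho> (ketbra (unit_vec m 0)) * dagger W) $$ (i, j) =
    (\<Sum>k<n. \<Sum>l<n. \<rho> $$ (k, l) * (\<Sum>a<m. W $$ (i * m + a, k * m) * cnj (W $$ (j * m + a, l * m))))"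
proof -
  let ?K = "kron \<rho> (ketbra (unit_vec m 0))"
  have K: "?K \<in> carrier_mat (n * m) (n * m)"
    using \<rho> by (auto simp: kron_def ketbra_def)
  have Kent: "?K $$ (k * m + b, l * m + c) = (if b = 0 then 1 else 0) * ((if c = 0 then 1 else 0) * \<rho> $$ (k, l))"
    if "k < n" "l < n" "b < m" "c < m" for k l b c
    using that \<rho> pair_index_less[OF that(1,3)] pair_index_less[OF that(2,4)]
    by (simp add: kron_def ketbra_def unit_vec_def)
  have "(W * ?K * dagger W) $$ (x, y) =
     (\<Sum>k<n. \<Sum>l<n. \<rho> $$ (k, l) * (W $$ (x, k * m) * cnj (W $$ (y, l * m))))"
    if xy: "x < n * m" "y < n * m" for x y
  proof -
    have WK: "(W * ?K) $$ (x, q) = (\<Sum>p<n * m. W $$ (x, p) * ?K $$ (p, q))" if "q < n * m" for q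
      by (rule index_mult_mat_sum[OF W K xy(1) that])
    have "(W * ?K * dagger W) $$ (x, y) = (\<Sum>q<n * m. (W * ?K) $$ (x, q) * dagger W $$ (q, y))"
      by (rule index_mult_mat_sum[OF mult_carrier_mat[OF W K] dagger_carrier[OF W] xy])
    also have "\<dots> = (\<Sum>q<n * m. (\<Sum>p<n * m. W $$ (x, p) * ?K $$ (p, q)) * cnj (W $$ (y, q)))"
      using W xy by (intro sum.cong refl) (simp add: WK dagger_def)
    also have "\<dots> = (\<Sum>l<n. \<Sum>c<m. (\<Sum>k<n. \<Sum>b<m. W $$ (x, k * m + b) * 
        ((if b = 0 then 1 else 0) * ((if c = 0 then 1 else 0) * \<rho> $$ (k, l)))) * cnj (W $$ (y, l * m + c)))"
      unfolding sum_lessThan_mult by (intro sum.cong refl) (simp add: Kent)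
    also have "\<dots> = (\<Sum>l<n. \<Sum>k<n. \<rho> $$ (k, l) * (W $$ (x, k * m) * cnj (W $$ (y, l * m))))"
    proof (rule sum.cong[OF refl])
      fix l
      have inner: "(\<Sum>b<m. W $$ (x, k * m + b) * ((if b = 0 then 1 else 0) * z)) = W $$ (x, k * m) * z" for k z
      proof -
        have "(\<Sum>b<m. W $$ (x, k * m + b) * ((if b = 0 then 1 else 0) * z)) =
          (\<Sum>b<m. if b = 0 then W $$ (x, k * m) * z else 0)" by (intro sum.cong refl) auto
        thus ?thesis using m by simp
      qed
      have "(\<Sum>c<m. (\<Sum>k<n. \<Sum>b<m. W $$ (x, k * m + b) * 
        ((if b = 0 then 1 else 0) * ((if c = 0 then 1 else 0) * \<rho> $$ (k, l)))) * cnj (W $$ (y, l * m + c)))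
        = (\<Sum>c<m. if c = 0 then (\<Sum>k<n. W $$ (x, k * m) * \<rho> $$ (k, l)) * cnj (W $$ (y, l * m)) else 0)"
        unfolding inner by (intro sum.cong refl) auto
      also have "\<dots> = (\<Sum>k<n. W $$ (x, k * m) * \<rho> $$ (k, l)) * cnj (W $$ (y, l * m))"
        using m by simp
      also have "\<dots> = (\<Sum>k<n. \<rho> $$ (k, l) * (W $$ (x, k * m) * cnj (W $$ (y, l * m))))"
        unfolding sum_distrib_right by (intro sum.cong refl) simp
      finally show "(\<Sum>c<m. (\<Sum>k<n. \<Sum>b<m. W $$ (x, k * m + b) * 
        ((if b = 0 then 1 else 0) * ((if c = 0 then 1 else 0) * \<rho> $$ (k, l)))) * cnj (W $$ (y, l * m + c)))
        = (\<Sum>k<n. \<rho> $$ (k, l) * (W $$ (x, k * m) * cnj (W $$ (y, l * m))))"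
        .
    qed
    also have "\<dots> = (\<Sum>k<n. \<Sum>l<n. \<rho> $$ (k, l) * (W $$ (x, k * m) * cnj (W $$ (y, l * m))))"
      by (rule sum.swap)
    finally show ?thesis .
  qed
  hence "ptrace_E n m (W * ?K * dagger W) $$ (i, j) = (\<Sum>a<m. \<Sum>k<n. \<Sum>l<n.
      \<rho> $$ (k, l) * (W $$ (i * m + a, k * m) * cnj (W $$ (j * m + a, l * m))))"
    using ij by (simp add: ptrace_E_def pair_index_less)
  also have "\<dots> = (\<Sum>k<n. \<Sum>a<m. \<Sum>l<n.
      \<rho> $$ (k, l) * (W $$ (i * m + a, k * m) * cnj (W $$ (j * m + a, l * m))))"
    by (rule sum.swap)
  also have "\<dots> = (\<Sum>k<n. \<Sum>l<n. \<Sum>a<m.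
      \<rho> $$ (k, l) * (W $$ (i * m + a, k * m) * cnj (W $$ (j * m + a, l * m))))"
    by (intro sum.cong refl sum.swap)
  finally show ?thesis by (simp add: sum_distrib_left)
qed

text \<open>\<open>J\<close> is any connected open set, which also lets the whole line carry a
  constant curve. There is one environment dimension for each column of the Cholesky factor.\<close>

lemma analytic_dilation_open_interval:
  fixes \<Phi> :: "real \<Rightarrow> complex mat \<Rightarrow> complex mat"
  assumes n: "n \<ge> 1" and J: "open J" "connected J"
    and \<Phi>: "\<And>t. t \<in> J \<Longrightarrow> CPTP n (\<Phi> t)"
    and an: "\<And>x k l i j. x \<in> J \<Longrightarrow> k < n \<Longrightarrow> l < n \<Longrightarrow> i < n \<Longrightarrow> j < n \<Longrightarrow>
       real_analytic_at (\<lambda>t. \<Phi> t (mat_unit n k l) $$ (i, j)) x"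
  shows "\<exists>U. (\<forall>t\<in>J. unitary_mat (n * n\<^sup>2) (U t) \<and> (\<forall>\<rho>\<in>carrier_mat n n.
        \<Phi> t \<rho> = ptrace_E n (n\<^sup>2) (U t * kron \<rho> (ketbra (unit_vec (n\<^sup>2) 0)) * dagger (U t)))) \<and>
    (\<forall>x\<in>J. \<forall>p<n * n\<^sup>2. \<forall>q<n * n\<^sup>2. real_analytic_at (\<lambda>t. U t $$ (p, q)) x)"
proof -
  define m where "m = n * n"
  have m: "m > 0" using n by (simp add: m_def)
  have "real_analytic_at (\<lambda>t. choi n (\<Phi> t) p q) x" if "x \<in> J" "p < m" "q < m" for x p q
    unfolding choi_def using that n
    by (intro an) (auto simp: m_def intro: less_mult_imp_div_less)
  moreover have "psd_form m (choi n (\<Phi> t))" if "t \<in> J" for t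
    unfolding m_def by (rule psd_form_choi[OF \<Phi>[OF that]])
  ultimately have "\<exists>L. (\<forall>x\<in>J. \<forall>i<m. \<forall>k<m. real_analytic_at (\<lambda>t. L t i k) x) \<and>
    (\<forall>t\<in>J. \<forall>i<m. \<forall>j<m. choi n (\<Phi> t) i j = (\<Sum>k<m. L t i k * cnj (L t j k)))" (is "\<exists>L. ?P L")
    by (intro analytic_cholesky[OF J])
  then obtain L where L: "?P L" by (elim exE) (rule that)
  have L_an: "\<And>x i k. x \<in> J \<Longrightarrow> i < m \<Longrightarrow> k < m \<Longrightarrow> real_analytic_at (\<lambda>t. L t i k) x" and
    L_choi: "\<And>t i j. t \<in> J \<Longrightarrow> i < m \<Longrightarrow> j < m \<Longrightarrow> choi n (\<Phi> t) i j = (\<Sum>k<m. L t i k * cnj (L t j k))"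
    using L by blast+
  \<comment> \<open>Row \<open>i * m + a\<close> and column \<open>k * m\<close> hold entry
    \<open>(i, k)\<close> of Kraus operator \<open>a\<close>, which is column \<open>a\<close> of
    the Cholesky factor read at the input-output pair \<open>k * n + i\<close>.\<close>
  define V where "V = (\<lambda>t p q. L t ((q div m) * n + p div m) (p mod m))"
  have V: "V t (i * m + a) (k * m) = L t (k * n + i) a" if "a < m" for t i a k
    using that by (simp add: V_def)
  \<comment> \<open>The columns belonging to the basis vectors of the system tensored with the
    initial environment state, the only ones that the channel prescribes.\<close>
  define K where "K = (\<lambda>k. k * m) ` {..<n}"
  have K: "finite K" "K \<subseteq> {..<n * m}" using m by (auto simp: K_def)
  have V_an: "real_analytic_at (\<lambda>t. V t p q) x" if pq: "x \<in> J" "p < n * m" "q \<in> K" for x p q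
    unfolding V_def
  proof (rule L_an[OF pq(1)])
    obtain k where "q = k * m" "k < n" using pq(3) by (auto simp: K_def)
    thus "q div m * n + p div m < m"
      using pq(2) m unfolding m_def by (intro pair_index_less) (simp_all add: less_mult_imp_div_less)
  qed (use m in simp)
  have V_col: "(\<Sum>p<n * m. cnj (V t p q) * V t p q') = (if q = q' then 1 else 0)"
    if t: "t \<in> J" and qK: "q \<in> K" "q' \<in> K" for t q q'
  proof -
    obtain k l where kl: "q = k * m" "q' = l * m" "k < n" "l < n" using qK by (auto simp: K_def)
    have "(\<Sum>p<n * m. cnj (V t p q) * V t p q') =
        (\<Sum>i<n. \<Sum>a<m. L t (l * n + i) a * cnj (L t (k * n + i) a))"
      unfolding sum_lessThan_mult kl by (intro sum.cong refl) (simp add: V)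
    \<comment> \<open>The inner product conjugates its first argument, so the pair
      \<open>(k, l)\<close> enters the Choi matrix as \<open>(l, k)\<close>.\<close>
    also have "\<dots> = (\<Sum>i<n. choi n (\<Phi> t) (l * n + i) (k * n + i))"
      using L_choi[OF t] kl pair_index_less[of _ n _ n] by (intro sum.cong refl) (simp add: m_def)
    also have "\<dots> = (if l = k then 1 else 0)" by (rule CPTP_choi_trace[OF \<Phi>[OF t] kl(4,3)])
    finally show ?thesis using m by (auto simp: kl)
  qed
  have "\<exists>W. (\<forall>x\<in>J. \<forall>p<n * m. \<forall>q<n * m. real_analytic_at (\<lambda>t. W t p q) x) \<and>
    (\<forall>t\<in>J. \<forall>q<n * m. \<forall>q'<n * m. (\<Sum>p<n * m. cnj (W t p q) * W t p q') = (if q = q' then 1 else 0)) \<and>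
    (\<forall>t\<in>J. \<forall>p<n * m. \<forall>k\<in>K. W t p k = V t p k)" (is "\<exists>W. ?P W")
    by (rule analytic_unitary_completion[OF J K V_an V_col])
  then obtain W where W: "?P W" by (elim exE) (rule that)
  have W_an: "\<And>x p q. x \<in> J \<Longrightarrow> p < n * m \<Longrightarrow> q < n * m \<Longrightarrow> real_analytic_at (\<lambda>t. W t p q) x" and
    W_col: "\<And>t q q'. t \<in> J \<Longrightarrow> q < n * m \<Longrightarrow> q' < n * m \<Longrightarrow>
       (\<Sum>p<n * m. cnj (W t p q) * W t p q') = (if q = q' then 1 else 0)" and
    WV: "\<And>t p k. t \<in> J \<Longrightarrow> p < n * m \<Longrightarrow> k \<in> K \<Longrightarrow> W t p k = V t p k"
    using W by blast+
  define U where "U = (\<lambda>t. mat (n * m) (n * m) (\<lambda>(p, q). W t p q))"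
  have U: "U t \<in> carrier_mat (n * m) (n * m)" for t by (simp add: U_def)
  have "unitary_mat (n * m) (U t)" if "t \<in> J" for t
    unfolding U_def using W_col[OF that] by (rule unitary_mat_of_orthonormal_columns)
  moreover have "\<Phi> t \<rho> = ptrace_E n m (U t * kron \<rho> (ketbra (unit_vec m 0)) * dagger (U t))"
    if t: "t \<in> J" and \<rho>: "\<rho> \<in> carrier_mat n n" for t \<rho>
  proof (rule eq_matI)
    have carr: "\<Phi> t \<rho> \<in> carrier_mat n n" using \<Phi>[OF t] \<rho> by (simp add: CPTP_def)
    show "dim_row (\<Phi> t \<rho>) = dim_row (ptrace_E n m (U t * kron \<rho> (ketbra (unit_vec m 0)) * dagger (U t)))"
      "dim_col (\<Phi> t \<rho>) = dim_col (ptrace_E n m (U t * kron \<rho> (ketbra (unit_vec m 0)) * dagger (U t)))"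
      using carr by (simp_all add: ptrace_E_def)
    fix i j assume "i < dim_row (ptrace_E n m (U t * kron \<rho> (ketbra (unit_vec m 0)) * dagger (U t)))"
      "j < dim_col (ptrace_E n m (U t * kron \<rho> (ketbra (unit_vec m 0)) * dagger (U t)))"
    hence ij: "i < n" "j < n" by (simp_all add: ptrace_E_def)
    have "U t $$ (i * m + a, k * m) = L t (k * n + i) a" if "i < n" "a < m" "k < n" for i a k
      using that m pair_index_less[OF that(1,2)] WV[OF t, of "i * m + a" "k * m"]
      by (simp add: U_def V K_def)
    hence "ptrace_E n m (U t * kron \<rho> (ketbra (unit_vec m 0)) * dagger (U t)) $$ (i, j) =
      (\<Sum>k<n. \<Sum>l<n. \<rho> $$ (k, l) * (\<Sum>a<m. L t (k * n + i) a * cnj (L t (l * n + j) a)))"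
      unfolding ptrace_dilation_index[OF m U \<rho> ij] using ij by simp
    also have "\<dots> = (\<Sum>k<n. \<Sum>l<n. \<rho> $$ (k, l) * \<Phi> t (mat_unit n k l) $$ (i, j))"
      using ij pair_index_less[of _ n _ n] L_choi[OF t]
      by (intro sum.cong refl) (simp add: m_def flip: choi_pair)
    also have "\<dots> = \<Phi> t \<rho> $$ (i, j)" using CPTP_matrix_units[OF \<Phi>[OF t] \<rho> ij] by simp
    finally show "\<Phi> t \<rho> $$ (i, j) = ptrace_E n m (U t * kron \<rho> (ketbra (unit_vec m 0)) * dagger (U t)) $$ (i, j)" ..
  qed
  moreover have "real_analytic_at (\<lambda>t. U t $$ (p, q)) x" if "x \<in> J" "p < n * m" "q < n * m" for x p q
    using W_an[OF that] that by (simp add: U_def)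
  ultimately show ?thesis unfolding power2_eq_square m_def[symmetric] by (intro exI[of _ U]) blast
qed

text \<open>Both claims of the theorem are instances: \<open>I\<close> is the half-open time
  interval and \<open>J\<close> its interior.\<close>

lemma analytic_unitary_dilationI:
  assumes n: "n \<ge> 1" and J: "open J" "connected J" "J \<subseteq> I"
    and \<Phi>: "\<And>t. t \<in> I \<Longrightarrow> CPTP n (\<Phi> t)"
    and an: "\<And>x k l i j. x \<in> J \<Longrightarrow> k < n \<Longrightarrow> l < n \<Longrightarrow> i < n \<Longrightarrow> j < n \<Longrightarrow>
       real_analytic_at (\<lambda>t. \<Phi> t (mat_unit n k l) $$ (i, j)) x"
  shows "analytic_unitary_dilation n \<Phi> I J"
proof -
  let ?dil = "\<lambda>t U. unitary_mat (n * n\<^sup>2) U \<and> (\<forall>\<rho>\<in>carrier_mat n n.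
        \<Phi> t \<rho> = ptrace_E n (n\<^sup>2) (U * kron \<rho> (ketbra (unit_vec (n\<^sup>2) 0)) * dagger U))"
  have "\<exists>U. (\<forall>t\<in>J. ?dil t (U t)) \<and>
    (\<forall>x\<in>J. \<forall>p<n * n\<^sup>2. \<forall>q<n * n\<^sup>2. real_analytic_at (\<lambda>t. U t $$ (p, q)) x)" (is "\<exists>U. ?P U")
    using J(3) by (intro analytic_dilation_open_interval[OF n J(1,2)] \<Phi> an) auto
  then obtain U where U: "?P U" by (elim exE) (rule that)
  have "\<exists>U. ?dil t U" if "t \<in> I" for t
    using analytic_dilation_open_interval[where \<Phi> = "\<lambda>_. \<Phi> t" and J = UNIV and n = n] n \<Phi>[OF that]
    by auto
  then obtain U' where U': "\<And>t. t \<in> I \<Longrightarrow> ?dil t (U' t)" by metis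
  define W where "W = (\<lambda>t. if t \<in> J then U t else U' t)"
  have W: "?dil t (W t)" if "t \<in> I" for t
  proof (cases "t \<in> J")
    case True
    hence W: "W t = U t" by (simp add: W_def)
    show ?thesis unfolding W using U True by blast
  next
    case False
    hence W: "W t = U' t" by (simp add: W_def)
    show ?thesis unfolding W by (rule U'[OF that])
  qed
  have "mat_analytic_on (n * n\<^sup>2) (n * n\<^sup>2) J W"
    unfolding mat_analytic_on_def
  proof (intro allI impI real_analytic_onI)
    fix p q x assume pq: "p < n * n\<^sup>2" "q < n * n\<^sup>2" "x \<in> J"
    \<comment> \<open>Since \<open>J\<close> is open, the unrelated values of \<open>W\<close>
      outside \<open>J\<close> do not affect germs at its points.\<close>
    have "\<forall>\<^sub>F t in nhds x. t \<in> J" using J(1) pq(3) by (rule eventually_nhds_in_open)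
    hence "\<forall>\<^sub>F t in nhds x. W t $$ (p, q) = U t $$ (p, q)"
      by eventually_elim (simp add: W_def)
    moreover have "real_analytic_at (\<lambda>t. U t $$ (p, q)) x" using U pq by blast
    ultimately show "real_analytic_at (\<lambda>t. W t $$ (p, q)) x" by (rule real_analytic_at_transfer[rotated])
  qed
  moreover have "unit_vector (n\<^sup>2) (unit_vec (n\<^sup>2) 0)"
  proof -
    have "(\<Sum>i<n\<^sup>2. (cmod (vec_index (unit_vec (n\<^sup>2) 0 :: complex vec) i))\<^sup>2) = (\<Sum>i<n\<^sup>2. if i = 0 then 1 else 0)"
      by (intro sum.cong refl) (auto simp: unit_vec_def)
    also have "\<dots> = 1" using n by simp
    finally show ?thesis by (simp add: unit_vector_def)
  qed
  ultimately have "n\<^sup>2 \<le> n\<^sup>2 \<and> unit_vector (n\<^sup>2) (unit_vec (n\<^sup>2) 0) \<and>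
      (\<forall>t\<in>I. unitary_mat (n * n\<^sup>2) (W t)) \<and>
      (\<forall>t\<in>I. \<forall>\<rho>\<in>carrier_mat n n.
         \<Phi> t \<rho> = ptrace_E n (n\<^sup>2) (W t * kron \<rho> (ketbra (unit_vec (n\<^sup>2) 0)) * dagger (W t))) \<and>
      mat_analytic_on (n * n\<^sup>2) (n * n\<^sup>2) J W"
    using W by blast
  thus ?thesis unfolding analytic_unitary_dilation_def by (intro exI)
qed

section \<open>Quantum dynamical semigroups\<close>

text \<open>Geometric growth of the derivatives is beaten by the factorial in the remainder. The
  mean value form of the remainder requires real values, so complex solutions are treated through
  real and imaginary parts.\<close>

lemma taylor_sums_real:
  fixes g :: "nat \<Rightarrow> real \<Rightarrow> real"
  assumes deriv: "\<And>m t. \<bar>t - x\<bar> \<le> r \<Longrightarrow> (g m has_real_derivative g (Suc m) t) (at t)"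
    and bd: "\<And>m t. \<bar>t - x\<bar> \<le> r \<Longrightarrow> \<bar>g m t\<bar> \<le> B * C ^ m"
    and y: "\<bar>y - x\<bar> \<le> r" and C: "C \<ge> 0"
  shows "(\<lambda>m. g m x / fact m * (y - x) ^ m) sums g 0 y"
proof (cases "y = x")
  case True
  have "(\<lambda>m. g m x / fact m * 0 ^ m) sums (g 0 x / fact 0)" by (rule powser_sums_zero)
  thus ?thesis using True by simp
next
  case False
  have r: "r \<ge> 0" using y by linarith
  have B: "B \<ge> 0" using bd[of x 0] r by simp
  define S where "S = (\<lambda>n. \<Sum>m<n. g m x / fact m * (y - x) ^ m)"
  have rem: "\<bar>S n - g 0 y\<bar> \<le> B * ((C * r) ^ n / fact n)" if n: "n > 0" for n
  proof -
    have *: "\<forall>m t. m < n \<and> x - r \<le> t \<and> t \<le> x + r \<longrightarrow> DERIV (g m) t :> g (Suc m) t"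
      using deriv by (auto simp: abs_le_iff)
    have "\<exists>t. (if y < x then y < t \<and> t < x else x < t \<and> t < y) \<and>
      g 0 y = (\<Sum>m<n. g m x / fact m * (y - x) ^ m) + g n t / fact n * (y - x) ^ n"
      by (rule Taylor[OF n refl *]) (use y r False in \<open>auto simp: abs_le_iff\<close>)
    then obtain t where t: "if y < x then y < t \<and> t < x else x < t \<and> t < y"
      "g 0 y = S n + g n t / fact n * (y - x) ^ n" unfolding S_def by blast
    have "\<bar>t - x\<bar> \<le> r" using t(1) y by (auto split: if_splits)
    hence "\<bar>g n t\<bar> \<le> B * C ^ n" by (rule bd)
    moreover have "\<bar>y - x\<bar> ^ n \<le> r ^ n" using y by (intro power_mono) auto
    ultimately have "\<bar>g n t\<bar> * \<bar>y - x\<bar> ^ n \<le> (B * C ^ n) * r ^ n"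
      using B C by (intro mult_mono) auto
    hence "\<bar>g n t\<bar> * \<bar>y - x\<bar> ^ n / fact n \<le> (B * C ^ n) * r ^ n / fact n"
      by (intro divide_right_mono) auto
    moreover have "\<bar>S n - g 0 y\<bar> = \<bar>g n t\<bar> * \<bar>y - x\<bar> ^ n / fact n"
      using t(2) by (simp add: abs_mult power_abs)
    ultimately show ?thesis by (simp add: power_mult_distrib mult_ac)
  qed
  have "(\<lambda>n. (C * r) ^ n / fact n) \<longlonglongrightarrow> 0"
    using summable_LIMSEQ_zero[OF summable_exp[of "C * r"]] by (simp add: field_simps)
  hence lim: "(\<lambda>n. B * ((C * r) ^ n / fact n)) \<longlonglongrightarrow> 0"
    by (rule tendsto_mult_right_zero)
  have "(\<lambda>n. S n - g 0 y) \<longlonglongrightarrow> 0"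
    by (rule Lim_null_comparison[OF _ lim])
       (use rem in \<open>auto simp: eventually_sequentially intro!: exI[of _ 1]\<close>)
  hence "S \<longlonglongrightarrow> g 0 y" by (rule LIM_zero_cancel)
  thus ?thesis by (simp add: sums_def S_def)
qed

text \<open>The equation expresses every derivative through \<open>u\<close> by repeated
  multiplication with \<open>L\<close>, so all derivatives exist and grow at most geometrically. The
  Taylor series is then summed directly, without a matrix exponential.\<close>

lemma linear_ode_real_analytic:
  fixes u :: "real \<Rightarrow> nat \<Rightarrow> complex" and L :: "nat \<Rightarrow> nat \<Rightarrow> complex"
  assumes J: "open J"
    and ode: "\<And>t j. t \<in> J \<Longrightarrow> j < D \<Longrightarrow>
      ((\<lambda>t. u t j) has_vector_derivative (\<Sum>k<D. u t k * L k j)) (at t)"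
    and j: "j < D"
  shows "real_analytic_on J (\<lambda>t. u t j)"
  unfolding real_analytic_on_def
proof
  fix x assume x: "x \<in> J"
  obtain r where r: "r > 0" "cball x r \<subseteq> J" using J x open_contains_cball by blast
  have inJ: "t \<in> J" if "\<bar>t - x\<bar> \<le> r" for t
    using r(2) that by (auto simp: dist_real_def abs_minus_commute subset_iff)
  \<comment> \<open>\<open>d m\<close> is the candidate for the \<open>m\<close>-th derivative,
    \<open>u\<close> multiplied \<open>m\<close> times by \<open>L\<close>.\<close>
  define d where "d = (\<lambda>m. rec_nat u (\<lambda>_ v t j. \<Sum>k<D. v t k * L k j) m)"
  have d0: "d 0 = u" and dS: "d (Suc m) = (\<lambda>t j. \<Sum>k<D. d m t k * L k j)" for m
    by (simp_all add: d_def)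
  have deriv: "((\<lambda>t. d m t j) has_vector_derivative d (Suc m) t j) (at t)" if "t \<in> J" "j < D" for m t j
    using that(2)
  proof (induction m arbitrary: j)
    case 0
    thus ?case using ode[OF that(1)] by (simp add: d0 dS)
  next
    case (Suc m)
    have "((\<lambda>t. \<Sum>k<D. d m t k * L k j) has_vector_derivative (\<Sum>k<D. d (Suc m) t k * L k j)) (at t)"
      by (intro has_vector_derivative_sum has_vector_derivative_mult_left Suc.IH) simp
    thus ?case by (simp add: dS[of m] dS[of "Suc m"])
  qed
  have cont: "continuous_on (cball x r) (\<lambda>t. u t k)" if "k < D" for k
  proof (intro continuous_at_imp_continuous_on ballI)
    fix t assume "t \<in> cball x r"
    hence "t \<in> J" using r by blast
    from ode[OF this that] show "isCont (\<lambda>t. u t k) t" by (rule has_vector_derivative_continuous)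
  qed
  have "\<exists>b. \<forall>t\<in>cball x r. norm (u t k) \<le> b" if "k < D" for k
    using compact_imp_bounded[OF compact_continuous_image[OF cont[OF that] compact_cball]]
    by (auto simp: bounded_iff)
  then obtain b where b: "\<And>k t. k < D \<Longrightarrow> t \<in> cball x r \<Longrightarrow> norm (u t k) \<le> b k" by metis
  define B where "B = (\<Sum>k<D. \<bar>b k\<bar>)"
  \<comment> \<open>The sum over all entries dominates every column sum of \<open>L\<close>, hence
    the growth from one derivative to the next.\<close>
  define C where "C = (\<Sum>k<D. \<Sum>j<D. norm (L k j))"
  have B: "norm (u t k) \<le> B" if "k < D" "\<bar>t - x\<bar> \<le> r" for k t
  proof -
    have "norm (u t k) \<le> \<bar>b k\<bar>" using b[of k t] that by (auto simp: dist_real_def abs_minus_commute)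
    also have "\<dots> \<le> B" unfolding B_def using that by (intro member_le_sum) auto
    finally show ?thesis .
  qed
  have B0: "B \<ge> 0" unfolding B_def by (intro sum_nonneg) simp
  have C0: "C \<ge> 0" unfolding C_def by (intro sum_nonneg) simp
  have bound: "norm (d m t j) \<le> B * C ^ m" if "\<bar>t - x\<bar> \<le> r" "j < D" for m t j
    using that(2)
  proof (induction m arbitrary: j)
    case 0
    thus ?case using B that(1) by (simp add: d0)
  next
    case (Suc m)
    have "norm (d (Suc m) t j) \<le> (\<Sum>k<D. norm (d m t k * L k j))"
      unfolding dS by (rule norm_sum)
    also have "\<dots> \<le> (\<Sum>k<D. B * C ^ m * norm (L k j))"
      unfolding norm_mult using Suc.IH by (intro sum_mono mult_right_mono) auto
    also have "\<dots> \<le> (\<Sum>k<D. B * C ^ m * (\<Sum>j<D. norm (L k j)))"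
      using Suc.prems B0 C0 by (intro sum_mono mult_left_mono member_le_sum) auto
    also have "\<dots> = B * C ^ Suc m"
      unfolding sum_distrib_left[symmetric] C_def[symmetric] by simp
    finally show ?case .
  qed
  have "(\<lambda>m. d m x j / fact m * complex_of_real (y - x) ^ m) sums u y j" if y: "\<bar>y - x\<bar> < r" for y
  proof -
    have "(\<lambda>m. Re (d m x j) / fact m * (y - x) ^ m) sums Re (d 0 y j)"
    proof (rule taylor_sums_real[where g = "\<lambda>m t. Re (d m t j)" and r = r and B = B and C = C])
      fix m t assume t: "\<bar>t - x\<bar> \<le> r"
      show "((\<lambda>t. Re (d m t j)) has_real_derivative Re (d (Suc m) t j)) (at t)"
        using deriv[OF inJ[OF t] j, of m] bounded_linear.has_vector_derivative[OF bounded_linear_Re]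
        by (simp add: has_real_derivative_iff_has_vector_derivative)
      show "\<bar>Re (d m t j)\<bar> \<le> B * C ^ m"
        using bound[OF t j, of m] abs_Re_le_cmod[of "d m t j"] by linarith
    qed (use y C0 in auto)
    moreover have "(\<lambda>m. Im (d m x j) / fact m * (y - x) ^ m) sums Im (d 0 y j)"
    proof (rule taylor_sums_real[where g = "\<lambda>m t. Im (d m t j)" and r = r and B = B and C = C])
      fix m t assume t: "\<bar>t - x\<bar> \<le> r"
      show "((\<lambda>t. Im (d m t j)) has_real_derivative Im (d (Suc m) t j)) (at t)"
        using deriv[OF inJ[OF t] j, of m] bounded_linear.has_vector_derivative[OF bounded_linear_Im]
        by (simp add: has_real_derivative_iff_has_vector_derivative)
      show "\<bar>Im (d m t j)\<bar> \<le> B * C ^ m"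
        using bound[OF t j, of m] abs_Im_le_cmod[of "d m t j"] by linarith
    qed (use y C0 in auto)
    moreover have "d m x j / fact m * complex_of_real (y - x) ^ m =
      Complex (Re (d m x j) / fact m * (y - x) ^ m) (Im (d m x j) / fact m * (y - x) ^ m)" for m
    proof -
      have "d m x j / fact m * complex_of_real (y - x) ^ m =
        complex_of_real ((y - x) ^ m / fact m) * d m x j" by simp
      thus ?thesis by (simp only: complex_eq_iff Re_complex_of_real Im_complex_of_real times_complex.sel complex.sel) simp
    qed
    ultimately show ?thesis by (simp add: sums_complex_iff d0)
  qed
  thus "\<exists>r>0. \<exists>c. \<forall>y\<in>J. \<bar>y - x\<bar> < r \<longrightarrow> (\<lambda>k. c k * complex_of_real (y - x) ^ k) sums u y j"
    using r(1) by (intro exI[of _ r] conjI exI[of _ "\<lambda>m. d m x j / fact m"]) auto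
qed

text \<open>The determinant is a polynomial in the entries, so it tends to 1 and is eventually
  nonzero.\<close>

lemma matrix_near_identity_inverse:
  fixes Y :: "real \<Rightarrow> nat \<Rightarrow> nat \<Rightarrow> complex"
  assumes lim: "\<And>p q. p < D \<Longrightarrow> q < D \<Longrightarrow> ((\<lambda>h. Y h p q) \<longlongrightarrow> (if p = q then 1 else 0)) F"
  shows "\<forall>\<^sub>F h in F. \<exists>Z. \<forall>p<D. \<forall>q<D. (\<Sum>r<D. Y h p r * Z r q) = (if p = q then 1 else 0)"
proof -
  define A where "A = (\<lambda>h. mat D D (\<lambda>(p, q). Y h p q))"
  have A: "A h \<in> carrier_mat D D" for h by (simp add: A_def)
  have perm: "\<pi> i < D" if "\<pi> permutes {0..<D}" "i < D" for \<pi> i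
    using permutes_in_image[OF that(1), of i] that(2) by simp
  have "((\<lambda>h. \<Sum>\<pi>\<in>{\<pi>. \<pi> permutes {0..<D}}. signof \<pi> * (\<Prod>i = 0..<D. A h $$ (i, \<pi> i))) \<longlongrightarrow>
     (\<Sum>\<pi>\<in>{\<pi>. \<pi> permutes {0..<D}}. signof \<pi> * (\<Prod>i = 0..<D. 1\<^sub>m D $$ (i, \<pi> i)))) F"
    by (intro tendsto_sum tendsto_mult tendsto_const tendsto_prod) (use lim perm in \<open>auto simp: A_def\<close>)
  hence "((\<lambda>h. Determinant.det (A h)) \<longlongrightarrow> Determinant.det (1\<^sub>m D :: complex mat)) F"
    by (simp only: det_def'[OF A] det_def'[OF one_carrier_mat])
  hence "((\<lambda>h. Determinant.det (A h)) \<longlongrightarrow> 1) F" by simp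
  hence "\<forall>\<^sub>F h in F. Determinant.det (A h) \<noteq> 0"
    by (rule tendsto_imp_eventually_ne) simp
  thus ?thesis
  proof eventually_elim
    case (elim h)
    from det_non_zero_imp_unit[OF A elim, of "()"] obtain Z where
      Z: "Z \<in> carrier_mat D D" "A h * Z = 1\<^sub>m D"
      unfolding Units_def ring_mat_def by auto
    have "(\<Sum>r<D. Y h p r * Z $$ (r, q)) = (if p = q then 1 else 0)" if "p < D" "q < D" for p q
    proof -
      have "(\<Sum>r<D. Y h p r * Z $$ (r, q)) = (A h * Z) $$ (p, q)"
        unfolding index_mult_mat_sum[OF A Z(1) that] using that by (intro sum.cong refl) (simp add: A_def)
      thus ?thesis using Z(2) that by simp
    qed
    thus ?case by (intro exI[of _ "\<lambda>r q. Z $$ (r, q)"]) blast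
  qed
qed

text \<open>With \<open>X\<close> the integral of \<open>M\<close> over \<open>[0, h]\<close>, the semigroup law gives that \<open>M t X\<close> is the integral of
  \<open>M\<close> over \<open>[t, t + h]\<close>; for small \<open>h\<close> the matrix \<open>X\<close> is invertible, so \<open>M\<close> is differentiable and solves a
  linear ODE.\<close>
lemma continuous_matrix_semigroup_real_analytic:
  fixes M :: "real \<Rightarrow> nat \<Rightarrow> nat \<Rightarrow> complex"
  assumes cont: "\<And>p q. p < D \<Longrightarrow> q < D \<Longrightarrow> continuous_on {0..} (\<lambda>t. M t p q)"
    and zero: "\<And>p q. p < D \<Longrightarrow> q < D \<Longrightarrow> M 0 p q = (if p = q then 1 else 0)"
    and add: "\<And>s t p q. 0 \<le> s \<Longrightarrow> 0 \<le> t \<Longrightarrow> p < D \<Longrightarrow> q < D \<Longrightarrow>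
       M (t + s) p q = (\<Sum>r<D. M t p r * M s r q)"
    and pq: "p < D" "q < D"
  shows "real_analytic_on {0<..} (\<lambda>t. M t p q)"
proof -
  define Q where "Q = (\<lambda>t p q. integral {0..t} (\<lambda>s. M s p q))"
  have cont': "continuous_on {a..b} (\<lambda>t. M t p q)" if "0 \<le> a" "p < D" "q < D" for a b p q
    using cont[OF that(2,3)] by (rule continuous_on_subset) (use that in auto)
  have intble: "(\<lambda>t. M t p q) integrable_on {a..b}" if "0 \<le> a" "p < D" "q < D" for a b p q
    using cont'[OF that] by (rule integrable_continuous_real)
  have Q_deriv: "((\<lambda>t. Q t p q) has_vector_derivative M t p q) (at t)" if "0 < t" "p < D" "q < D" for t p q
  proof -
    have "((\<lambda>t. Q t p q) has_vector_derivative M t p q) (at t within {0..t + 1})"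
      unfolding Q_def using that by (intro integral_has_vector_derivative cont') auto
    thus ?thesis using that by (simp add: at_within_Icc_at)
  qed
  \<comment> \<open>The one-sided derivative at 0 of the integral is \<open>M 0\<close>, the
    identity; this is where continuity at 0 enters.\<close>
  have lim: "((\<lambda>h. Q h p q / complex_of_real h) \<longlongrightarrow> (if p = q then 1 else 0)) (at 0 within {0..1})"
    if "p < D" "q < D" for p q
  proof -
    have "((\<lambda>t. Q t p q) has_vector_derivative M 0 p q) (at 0 within {0..1})"
      unfolding Q_def using that by (intro integral_has_vector_derivative cont') auto
    hence "((\<lambda>h. (1 / norm (h - 0)) *\<^sub>R (Q h p q - (Q 0 p q + (h - 0) *\<^sub>R M 0 p q))) \<longlongrightarrow> 0) (at 0 within {0..1})"
      by (simp only: has_vector_derivative_def has_derivative_within)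
    moreover have "\<forall>\<^sub>F h in at 0 within {0..1}. (1 / norm (h - 0)) *\<^sub>R (Q h p q - (Q 0 p q + (h - 0) *\<^sub>R M 0 p q))
        = Q h p q / complex_of_real h - (if p = q then 1 else 0)"
      by (auto simp: eventually_at_filter zero[OF that] Q_def scaleR_conv_of_real field_simps)
    ultimately have "((\<lambda>h. Q h p q / complex_of_real h - (if p = q then 1 else 0)) \<longlongrightarrow> 0) (at 0 within {0..1})"
      by (rule Lim_transform_eventually)
    thus ?thesis by (rule LIM_zero_cancel)
  qed
  have "\<forall>\<^sub>F h in at 0 within {0..1}. \<exists>Z. \<forall>p<D. \<forall>q<D.
      (\<Sum>r<D. Q h p r / complex_of_real h * Z r q) = (if p = q then 1 else 0)"
    by (rule matrix_near_identity_inverse[OF lim])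
  moreover have "\<forall>\<^sub>F h in at 0 within {0..1::real}. h > 0"
    by (auto simp: eventually_at_filter)
  moreover have "at 0 within {0..1::real} \<noteq> bot"
    by (simp add: at_within_Icc_at_right)
  ultimately have "\<exists>h. (\<exists>Z. \<forall>p<D. \<forall>q<D.
      (\<Sum>r<D. Q h p r / complex_of_real h * Z r q) = (if p = q then 1 else 0)) \<and> h > 0"
    by (intro eventually_happens' eventually_conj)
  then obtain h Z where h: "h > 0" and
    "\<forall>p<D. \<forall>q<D. (\<Sum>r<D. Q h p r / complex_of_real h * Z r q) = (if p = q then 1 else 0)"
    by (elim exE conjE) (rule that)
  \<comment> \<open>With \<open>h\<close> fixed from here on, \<open>Z\<close> divided by
    \<open>h\<close> is a right inverse of \<open>Q h\<close>.\<close>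
  hence Z: "(\<Sum>r<D. Q h p r / complex_of_real h * Z r q) = (if p = q then 1 else 0)"
    if "p < D" "q < D" for p q
    using that by blast
  have MQ: "(\<Sum>r<D. M t p r * Q h r q) = Q (t + h) p q - Q t p q" if "0 \<le> t" "p < D" "q < D" for t p q
  proof -
    have "(\<Sum>r<D. M t p r * Q h r q) = integral {0..h} (\<lambda>s. \<Sum>r<D. M t p r * M s r q)"
      unfolding Q_def using intble that
      by (subst integral_sum) (auto intro: integrable_on_mult_right)
    also have "\<dots> = integral {0..h} (\<lambda>s. M (s + t) p q)"
      using add that by (intro integral_cong) (simp add: add.commute)
    also have "\<dots> = integral {t..t + h} (\<lambda>s. M s p q)"
      using integral_shift_real_ivl[where a = t and c = t and b = "t + h" and f = "\<lambda>s. M s p q"] by simp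
    also have "\<dots> = Q (t + h) p q - Q t p q"
    proof -
      have "Q t p q + integral {t..t + h} (\<lambda>s. M s p q) = Q (t + h) p q"
        unfolding Q_def by (rule Henstock_Kurzweil_Integration.integral_combine[where f = "\<lambda>s. M s p q"]) (use that h intble in auto)
      thus ?thesis by (simp add: algebra_simps)
    qed
    finally show ?thesis .
  qed
  have M_eq: "M t p q = (\<Sum>r<D. (Q (t + h) p r - Q t p r) * (Z r q / complex_of_real h))"
    if "0 \<le> t" "p < D" "q < D" for t p q
  proof -
    have "(\<Sum>r<D. (Q (t + h) p r - Q t p r) * (Z r q / complex_of_real h)) =
      (\<Sum>r<D. \<Sum>k<D. M t p k * (Q h k r / complex_of_real h * Z r q))"
      using that by (intro sum.cong refl)
        (simp only: lessThan_iff MQ[symmetric] sum_distrib_right sum_divide_distrib times_divide_eq_right times_divide_eq_left mult.assoc)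
    also have "\<dots> = (\<Sum>k<D. \<Sum>r<D. M t p k * (Q h k r / complex_of_real h * Z r q))"
      by (rule sum.swap)
    also have "\<dots> = (\<Sum>k<D. M t p k * (if k = q then 1 else 0))"
      by (intro sum.cong refl) (simp only: sum_distrib_left[symmetric] lessThan_iff Z[OF _ that(3)])
    finally show ?thesis using that by (simp add: mult_delta_right)
  qed
  \<comment> \<open>Differentiating \<open>M_eq\<close> produces
    \<open>M (t + h) - M t = M t (M h - 1)\<close>, so the generator is \<open>M h - 1\<close> times
    the inverse of \<open>Q h\<close>.\<close>
  define L where "L = (\<lambda>k q. \<Sum>r<D. (M h k r - (if k = r then 1 else 0)) * (Z r q / complex_of_real h))"
  have ode: "((\<lambda>t. M t p q) has_vector_derivative (\<Sum>k<D. M t p k * L k q)) (at t)"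
    if "t \<in> {0<..}" "p < D" "q < D" for t p q
  proof -
    have t: "0 < t" using that by simp
    have Q_shift: "((\<lambda>t. Q (t + h) p r) has_vector_derivative M (t + h) p r) (at t)" if "r < D" for r
    proof -
      have "((\<lambda>t. t + h) has_vector_derivative 1) (at t)"
        by (auto intro!: derivative_eq_intros)
      from vector_diff_chain_at[OF this Q_deriv[of "t + h" p r]] show ?thesis
        using t h \<open>p < D\<close> that by (simp add: o_def)
    qed
    have "((\<lambda>t. \<Sum>r<D. (Q (t + h) p r - Q t p r) * (Z r q / complex_of_real h)) has_vector_derivative
      (\<Sum>r<D. (M (t + h) p r - M t p r) * (Z r q / complex_of_real h))) (at t)"
      using t that by (intro has_vector_derivative_sum has_vector_derivative_mult_left
          has_vector_derivative_diff Q_shift Q_deriv) auto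
    moreover have "(\<Sum>r<D. (M (t + h) p r - M t p r) * (Z r q / complex_of_real h)) = (\<Sum>k<D. M t p k * L k q)"
    proof -
      have "M (t + h) p r - M t p r = (\<Sum>k<D. M t p k * (M h k r - (if k = r then 1 else 0)))" if "r < D" for r
        using add[of h t p r] t h \<open>p < D\<close> that
        by (simp add: right_diff_distrib sum_subtractf mult_delta_right)
      hence "(\<Sum>r<D. (M (t + h) p r - M t p r) * (Z r q / complex_of_real h)) =
        (\<Sum>r<D. \<Sum>k<D. M t p k * ((M h k r - (if k = r then 1 else 0)) * (Z r q / complex_of_real h)))"
        by (intro sum.cong refl) (simp only: lessThan_iff sum_distrib_right mult.assoc)
      also have "\<dots> = (\<Sum>k<D. \<Sum>r<D. M t p k * ((M h k r - (if k = r then 1 else 0)) * (Z r q / complex_of_real h)))"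
        by (rule sum.swap)
      finally show ?thesis by (simp only: L_def sum_distrib_left)
    qed
    ultimately have "((\<lambda>t. \<Sum>r<D. (Q (t + h) p r - Q t p r) * (Z r q / complex_of_real h)) has_vector_derivative
      (\<Sum>k<D. M t p k * L k q)) (at t)" by (simp only:)
    \<comment> \<open>\<open>M_eq\<close> holds for nonnegative times only, so the derivative is
      transferred on the open half-line.\<close>
    thus ?thesis
    proof (rule has_vector_derivative_transform_within_open[of _ _ _ "{0<..}"])
      fix s assume "s \<in> {0::real<..}"
      thus "(\<Sum>r<D. (Q (s + h) p r - Q s p r) * (Z r q / complex_of_real h)) = M s p q"
        using M_eq[of s p q] that by simp
    qed (use t in auto)
  qed
  have "open {0::real<..}" by simp
  \<comment> \<open>Multiplication by \<open>L\<close> from the right makes each row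
    \<open>p\<close> of \<open>M\<close> a solution by itself.\<close>
  from linear_ode_real_analytic[OF this ode[OF _ pq(1)] pq(2)] show ?thesis by simp
qed

lemma quantum_dynamical_semigroup_real_analytic:
  assumes \<Psi>: "quantum_dynamical_semigroup n \<Psi>" and kl: "k < n" "l < n" and ij: "i < n" "j < n"
  shows "real_analytic_on {0<..} (\<lambda>t. \<Psi> t (mat_unit n k l) $$ (i, j))"
proof -
  \<comment> \<open>The matrix of the map in the basis of matrix units: \<open>q\<close> encodes the
    input unit and \<open>p\<close> the output entry. In contrast to \<open>choi\<close>, this
    indexing turns composition into the matrix product.\<close>
  define M where "M = (\<lambda>t p q. \<Psi> t (mat_unit n (q div n) (q mod n)) $$ (p div n, p mod n))"
  have n: "n > 0" using kl by simp
  have E: "mat_unit n k l \<in> carrier_mat n n" for k l by (simp add: mat_unit_def)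
  have idx: "p div n < n" "p mod n < n" if "p < n * n" for p
    using that n by (auto intro: less_mult_imp_div_less)
  have cptp: "CPTP n (\<Psi> t)" if "0 \<le> t" for t
    using \<Psi> that by (simp add: quantum_dynamical_semigroup_def)
  have "real_analytic_on {0<..} (\<lambda>t. M t (i * n + j) (k * n + l))"
  proof (rule continuous_matrix_semigroup_real_analytic[where D = "n * n"])
    show "continuous_on {0..} (\<lambda>t. M t p q)" if "p < n * n" "q < n * n" for p q
      using \<Psi> idx[OF that(1)] idx[OF that(2)]
      by (simp add: quantum_dynamical_semigroup_def map_continuous_on_def M_def)
    show "M 0 p q = (if p = q then 1 else 0)" if "p < n * n" "q < n * n" for p q
    proof -
      have "M 0 p q = mat_unit n (q div n) (q mod n) $$ (p div n, p mod n)"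
        using \<Psi> E by (simp add: quantum_dynamical_semigroup_def M_def)
      also have "\<dots> = (if p div n = q div n \<and> p mod n = q mod n then 1 else 0)"
        using idx that by (simp add: mat_unit_def)
      also have "(p div n = q div n \<and> p mod n = q mod n) \<longleftrightarrow> p = q"
        by (metis div_mult_mod_eq)
      finally show ?thesis .
    qed
    show "M (t + s) p q = (\<Sum>r<n * n. M t p r * M s r q)"
      if "0 \<le> s" "0 \<le> t" "p < n * n" "q < n * n" for s t p q
    proof -
      let ?E = "mat_unit n (q div n) (q mod n)"
      have carr: "\<Psi> s ?E \<in> carrier_mat n n"
        using cptp[OF that(1)] E by (simp add: CPTP_def)
      have "M (t + s) p q = \<Psi> t (\<Psi> s ?E) $$ (p div n, p mod n)"
        using \<Psi> that E by (simp add: quantum_dynamical_semigroup_def M_def)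
      also have "\<dots> = (\<Sum>k<n. \<Sum>l<n. \<Psi> s ?E $$ (k, l) * \<Psi> t (mat_unit n k l) $$ (p div n, p mod n))"
        by (rule CPTP_matrix_units[OF cptp[OF that(2)] carr idx[OF that(3)]])
      also have "\<dots> = (\<Sum>r<n * n. M t p r * M s r q)"
        unfolding sum_lessThan_mult by (intro sum.cong refl) (simp add: M_def)
      finally show ?thesis .
    qed
  qed (use pair_index_less kl ij in auto)
  thus ?thesis using kl ij by (simp add: M_def)
qed

theorem theorem4p2:
  fixes n :: nat and tf :: ereal
    and \<Phi> :: "real \<Rightarrow> complex mat \<Rightarrow> complex mat"
    and \<Psi> :: "real \<Rightarrow> complex mat \<Rightarrow> complex mat"
  assumes "n \<ge> 1"
  shows "(tf > 0 \<and> (\<forall>t \<in> {t. 0 \<le> t \<and> ereal t < tf}. CPTP n (\<Phi> t))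
            \<and> map_analytic_on n {t. 0 \<le> t \<and> ereal t < tf} \<Phi>
          \<longrightarrow> analytic_unitary_dilation n \<Phi> {t. 0 \<le> t \<and> ereal t < tf} {t. 0 < t \<and> ereal t < tf})
       \<and> (quantum_dynamical_semigroup n \<Psi> \<longrightarrow> analytic_unitary_dilation n \<Psi> {0..} {0<..})"
proof (intro conjI impI; (elim conjE)?)
  let ?I = "{t. 0 \<le> t \<and> ereal t < tf}" and ?J = "{t. 0 < t \<and> ereal t < tf}"
  assume \<Phi>: "\<forall>t \<in> ?I. CPTP n (\<Phi> t)" "map_analytic_on n ?I \<Phi>"
  have J: "open ?J" "?J \<subseteq> ?I"
    by (auto intro!: open_Collect_conj open_Collect_less continuous_intros)
  have conn: "connected ?J"
  proof -
    have "is_interval ?J"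
      unfolding is_interval_1 by (auto intro: le_less_trans[of "ereal _" "ereal _"])
    thus ?thesis by (simp add: is_interval_connected)
  qed
  show "analytic_unitary_dilation n \<Phi> ?I ?J"
  proof (rule analytic_unitary_dilationI[OF assms J(1) conn J(2)])
    fix x k l i j assume *: "x \<in> ?J" "k < n" "l < n" "i < n" "j < n"
    \<comment> \<open>The hypothesis is analyticity relative to the half-open interval; at points of
      \<open>?J\<close> it yields a two-sided germ.\<close>
    hence "real_analytic_on ?I (\<lambda>t. \<Phi> t (mat_unit n k l) $$ (i, j))"
      using \<Phi>(2) by (simp add: map_analytic_on_def mat_analytic_on_def)
    thus "real_analytic_at (\<lambda>t. \<Phi> t (mat_unit n k l) $$ (i, j)) x"
      using J *(1) by (rule real_analytic_on_imp_at)
  qed (use \<Phi>(1) in auto)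
next
  assume \<Psi>: "quantum_dynamical_semigroup n \<Psi>"
  show "analytic_unitary_dilation n \<Psi> {0..} {0<..}"
  proof (rule analytic_unitary_dilationI[OF assms])
    fix x k l i j assume *: "x \<in> {0::real<..}" "k < n" "l < n" "i < n" "j < n"
    show "real_analytic_at (\<lambda>t. \<Psi> t (mat_unit n k l) $$ (i, j)) x"
      by (rule real_analytic_on_imp_at[OF quantum_dynamical_semigroup_real_analytic[OF \<Psi> *(2-5)] _ _ *(1)]) auto
  qed (use \<Psi> in \<open>auto simp: quantum_dynamical_semigroup_def\<close>)
qed

end
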